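(* Let $G$ be an $\mathsf{LL}(k)$ grammar with terminal alphabet $\Sigma$. There is a randomized one-pass streaming algorithm that, given an input $w \in \Sigma^n$ and a positive integer $b$, uses space $O(b \log n)$ (where the hidden constant depends on the grammar $G$, including on $k$) and (1) accepts with probability $1$ if $w \in L(G)$ and $\mathrm{rank}_G(w) \leq b$; (2) rejects with probability at least $1 - \frac{1}{n}$ if $w \notin L(G)$ or $\mathrm{rank}_G(w) > b$.
   Context: For a context-free grammar $G=(N,\Sigma,P,S)$ and $w\in\Sigma^*$, let $\mathrm{pref}_k(w)$ be the first $k$ characters of $w$ if $|w|>k$, and $w$ otherwise. The select set of a production $A \rightarrow \alpha$ ($A\in N$, $\alpha\in(N\cup\Sigma)^*$) is $\mathrm{SELECT}(A\rightarrow\alpha)=\{u : \exists v, w\in\Sigma^*,\ \alpha v \text{ derives } w \text{ and } \mathrm{pref}_k(w)=u\}$. $G$ is an $\mathsf{LL}(k)$ grammar if for any two distinct productions $A\rightarrow\alpha$, $A\rightarrow\beta$ with the same left-hand side, their select sets are disjoint. For $w\in L(G)$, $\mathrm{rank}_G(w)$ is the maximum number of nonterminals in any sentential form arising in the (unique) leftmost derivation of $w$. A one-pass streaming algorithm reads the input once from left to right (knowing $n$); its space is the number of bits of working memory used. *)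

theory Defs
  imports "HOL-Probability.Probability" "HOL-Library.Log_Nat"
begin

section \<open>Context-free grammars\<close>

datatype ('n, 't) symbol = Nt 'n | Tm 't

record ('n, 't) cfg =
  nonterminals :: "'n set"
  alphabet :: "'t set"
  productions :: "('n \<times> ('n, 't) symbol list) set"
  start :: 'n

definition wf_cfg :: "('n, 't) cfg \<Rightarrow> bool" where
  "wf_cfg G \<longleftrightarrow>
     finite (nonterminals G) \<and> finite (alphabet G) \<and> finite (productions G) \<and>
     start G \<in> nonterminals G \<and>
     (\<forall>(A, \<alpha>) \<in> productions G. A \<in> nonterminals G \<and>
        set \<alpha> \<subseteq> Nt ` nonterminals G \<union> Tm ` alphabet G)"

definition derive_step :: "('n, 't) cfg \<Rightarrow> ('n, 't) symbol list \<Rightarrow> ('n, 't) symbol list \<Rightarrow> bool" where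
  "derive_step G x y \<longleftrightarrow>
     (\<exists>u A v \<alpha>. (A, \<alpha>) \<in> productions G \<and> x = u @ [Nt A] @ v \<and> y = u @ \<alpha> @ v)"

abbreviation derives :: "('n, 't) cfg \<Rightarrow> ('n, 't) symbol list \<Rightarrow> ('n, 't) symbol list \<Rightarrow> bool" where
  "derives G \<equiv> (derive_step G)\<^sup>*\<^sup>*"

definition lang :: "('n, 't) cfg \<Rightarrow> 't list set" where
  "lang G = {w \<in> lists (alphabet G). derives G [Nt (start G)] (map Tm w)}"

text \<open>Note that \<open>take k w\<close> is all of \<open>w\<close> when \<open>w\<close> has at most \<open>k\<close> letters, so it is the
  \<open>k\<close>-prefix in the sense needed here. The string \<open>v\<close> is an arbitrary terminal string, not one
  that can follow the left-hand side in a sentential form.\<close>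

definition select :: "('n, 't) cfg \<Rightarrow> nat \<Rightarrow> 'n \<times> ('n, 't) symbol list \<Rightarrow> 't list set" where
  "select G k p =
     {u. \<exists>v \<in> lists (alphabet G). \<exists>w \<in> lists (alphabet G).
           derives G (snd p @ map Tm v) (map Tm w) \<and> take k w = u}"

definition LL :: "nat \<Rightarrow> ('n, 't) cfg \<Rightarrow> bool" where
  "LL k G \<longleftrightarrow>
     (\<forall>p \<in> productions G. \<forall>q \<in> productions G.
        fst p = fst q \<and> p \<noteq> q \<longrightarrow> select G k p \<inter> select G k q = {})"

definition leftmost_step :: "('n, 't) cfg \<Rightarrow> ('n, 't) symbol list \<Rightarrow> ('n, 't) symbol list \<Rightarrow> bool" where
  "leftmost_step G x y \<longleftrightarrow>
     (\<exists>u A v \<alpha>. (A, \<alpha>) \<in> productions G \<and> x = map Tm u @ [Nt A] @ v \<and> y = map Tm u @ \<alpha> @ v)"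

definition leftmost_derivation ::
    "('n, 't) cfg \<Rightarrow> 't list \<Rightarrow> ('n, 't) symbol list list \<Rightarrow> bool" where
  "leftmost_derivation G w xs \<longleftrightarrow>
     xs \<noteq> [] \<and> hd xs = [Nt (start G)] \<and> last xs = map Tm w \<and> successively (leftmost_step G) xs"

definition num_nonterminals :: "('n, 't) symbol list \<Rightarrow> nat" where
  "num_nonterminals x = length (filter (\<lambda>s. \<exists>A. s = Nt A) x)"

text \<open>Only meaningful if \<open>w\<close> has exactly one leftmost derivation, which is the case for
  the words of an \<open>LL k\<close> grammar.\<close>

definition grammar_rank :: "('n, 't) cfg \<Rightarrow> 't list \<Rightarrow> nat" where
  "grammar_rank G w = Max (num_nonterminals ` set (THE xs. leftmost_derivation G w xs))"


section \<open>Randomized one-pass streaming algorithms\<close>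

text \<open>A streaming algorithm is a single randomized WHILE program that serves all input
  lengths. Its working memory consists of variables (numbered by \<open>nat\<close>) that hold natural
  numbers. The input can only be accessed by \<open>Read\<close>, which consumes the next input letter,
  looks it up in a constant table (a finite one, as the alphabet is finite) and stores the result (the table entry at \<open>None\<close> signals
  the end of the input). The only source of randomness is \<open>Flip\<close>, which stores the outcome of a
  fair coin toss; outcomes that are to be used later have to be kept in memory.\<close>

datatype expr =
    Const nat | Var nat
  | Plus expr expr | Minus expr expr | Times expr expr | Quot expr expr | Rem expr expr

primrec val :: "expr \<Rightarrow> (nat \<Rightarrow> nat) \<Rightarrow> nat" where
  "val (Const c) s = c"
| "val (Var x) s = s x"
| "val (Plus a b) s = val a s + val b s"
| "val (Minus a b) s = val a s - val b s"
| "val (Times a b) s = val a s * val b s"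
| "val (Quot a b) s = val a s div val b s"
| "val (Rem a b) s = val a s mod val b s"

datatype 't prog =
    Skip
  | Assign nat expr
  | Read nat "'t option \<Rightarrow> nat"
  | Flip nat
  | Seq "'t prog" "'t prog"
  | Cond expr "'t prog" "'t prog"
  | While expr "'t prog"

text \<open>A configuration consists of the residual program, the memory and the unread input.
  Conditions are true if their value is not \<open>0\<close>, and \<open>Skip\<close> is the halted program.\<close>

type_synonym 't config = "'t prog \<times> (nat \<Rightarrow> nat) \<times> 't list"

primrec small_step :: "'t prog \<Rightarrow> (nat \<Rightarrow> nat) \<Rightarrow> 't list \<Rightarrow> 't config pmf" where
  "small_step Skip s ws = return_pmf (Skip, s, ws)"
| "small_step (Assign x a) s ws = return_pmf (Skip, s(x := val a s), ws)"
| "small_step (Read x f) s ws =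
     return_pmf (case ws of
         [] \<Rightarrow> (Skip, s(x := f None), [])
       | w # ws' \<Rightarrow> (Skip, s(x := f (Some w)), ws'))"
| "small_step (Flip x) s ws =
     map_pmf (\<lambda>h. (Skip, s(x := (if h then 1 else 0)), ws)) (bernoulli_pmf (1 / 2))"
| "small_step (Seq c d) s ws =
     (if c = Skip then return_pmf (d, s, ws)
      else map_pmf (\<lambda>(c', s', ws'). (Seq c' d, s', ws')) (small_step c s ws))"
| "small_step (Cond a c d) s ws = return_pmf (if val a s \<noteq> 0 then c else d, s, ws)"
| "small_step (While a c) s ws =
     return_pmf (if val a s \<noteq> 0 then Seq c (While a c) else Skip, s, ws)"

primrec steps :: "nat \<Rightarrow> 't config \<Rightarrow> 't config pmf" where
  "steps 0 c = return_pmf c"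
| "steps (Suc t) c = bind_pmf (steps t c) (\<lambda>(p, s, ws). small_step p s ws)"

text \<open>Initially variable \<open>0\<close> holds the input length and variable \<open>1\<close> the parameter \<open>b\<close>; all
  others hold \<open>0\<close>. On halting, variable \<open>2\<close> holds the answer.\<close>

definition init :: "'t prog \<Rightarrow> nat \<Rightarrow> 't list \<Rightarrow> 't config" where
  "init p b w = (p, (\<lambda>_. 0)(0 := length w, 1 := b), w)"

definition accepting :: "'t config set" where
  "accepting = {(p, s, ws). p = Skip \<and> s 2 \<noteq> 0}"

definition rejecting :: "'t config set" where
  "rejecting = {(p, s, ws). p = Skip \<and> s 2 = 0}"

text \<open>Halted configurations are fixed points of \<open>small_step\<close>, so the probability of having
  accepted within \<open>t\<close> steps is monotone in \<open>t\<close> and the supremum is the probability that the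
  program halts and accepts.\<close>

definition accept_prob :: "'t prog \<Rightarrow> nat \<Rightarrow> 't list \<Rightarrow> real" where
  "accept_prob p b w = (SUP t. measure_pmf.prob (steps t (init p b w)) accepting)"

definition reject_prob :: "'t prog \<Rightarrow> nat \<Rightarrow> 't list \<Rightarrow> real" where
  "reject_prob p b w = (SUP t. measure_pmf.prob (steps t (init p b w)) rejecting)"

text \<open>\<open>floorlog 2 m\<close> is the length of the binary representation of \<open>m\<close> (\<open>0\<close> for \<open>m = 0\<close>). The sum
  ranges over a finite set in every reachable configuration. The program itself, and hence the
  control state and the number of variables, has constant size; so has each expression,
  whose evaluation needs work space linear in the number of bits of the variables. Neither
  affects the asymptotic space bound.\<close>

definition memory_bits :: "(nat \<Rightarrow> nat) \<Rightarrow> nat" where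
  "memory_bits s = (\<Sum>x | s x \<noteq> 0. floorlog 2 (s x))"

definition uses_space :: "'t prog \<Rightarrow> nat \<Rightarrow> 't list \<Rightarrow> real \<Rightarrow> bool" where
  "uses_space p b w B \<longleftrightarrow>
     (\<forall>t. \<forall>(p', s, ws) \<in> set_pmf (steps t (init p b w)). real (memory_bits s) \<le> B)"

end

theory Submission
  imports Defs
begin

text \<open>The algorithm simulates the leftmost parse, choosing each production by the next letters of the
  input, but it does not compare the terminals that it predicts with the input. So its control flow
  does not depend on the coin flips, and on each input it predicts at most one word. That word
  equals the input iff the input is in the language and has rank at most \<open>b\<close>, and equality is
  tested by one polynomial fingerprint modulo a prime \<open>p > n\<^sup>2\<close> at a random point. The stack
  consists of at most \<open>b\<close> nonterminals, each followed by a terminal block of which only the length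
  and the fingerprint are kept. A step budget of size \<open>n\<close> to the power \<open>O(b)\<close> makes the simulation
  terminate: a successful parse repeats no pair of an input position and a list of nonterminals with
  block lengths.\<close>

section \<open>Leftmost parsing with lookahead\<close>

text \<open>Two distinct words of length n collide at fewer than n points, and only one word
  competes with the input, so n^2 equally likely points bound the error by 1/n without a union
  bound. Fair coins are exactly uniform only on powers of two; hence the point is drawn below the
  least power of two Q >= n^2. The modulus is the least prime that is at least Q + \<open>W\<close>:
  distinct points and distinct letter codes stay distinct residues. Running time is free, so trial
  division finds it, and a weak prime gap suffices, as a prime polynomial in n has O(log n) bits.
  With the modulus plus a constant as base, three digits per nonterminal make the stack one number
  of O(b log n) bits. A right-hand side is pushed before the limits are checked, so the count of
  nonterminals may briefly exceed b by up to the maximal length \<open>m\<close> of right-hand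
  sides; as b >= 1, this costs only a constant factor. Space is claimed for every configuration of
  every run, so the program logic carries a memory invariant through each single step. Coins occur
  only in the drawing loop; what follows is one deterministic run per point.\<close>

inductive yields :: "('n, 't) cfg \<Rightarrow> ('n, 't) symbol list \<Rightarrow> 't list \<Rightarrow> bool" for G where
  yields_Nil: "yields G [] []"
| yields_Tm: "yields G \<gamma> w \<Longrightarrow> yields G (Tm a # \<gamma>) (a # w)"
| yields_Nt: "(A, \<alpha>) \<in> productions G \<Longrightarrow> yields G (\<alpha> @ \<gamma>) w \<Longrightarrow> yields G (Nt A # \<gamma>) w"

lemma yields_append:
  "yields G \<gamma> u \<Longrightarrow> yields G \<delta> v \<Longrightarrow> yields G (\<gamma> @ \<delta>) (u @ v)"
  by (induction rule: yields.induct) (auto intro: yields.intros)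

text \<open>Context-freeness: a symbol of \<gamma> is expanded within \<gamma>, so the two parts
  never mix. The induction fixes the right part and lets the left part vary.\<close>

lemma yields_split:
  "yields G (\<gamma> @ \<delta>) w \<Longrightarrow> \<exists>u v. w = u @ v \<and> yields G \<gamma> u \<and> yields G \<delta> v"
proof (induction "\<gamma> @ \<delta>" w arbitrary: \<gamma> rule: yields.induct)
  case yields_Nil
  then show ?case by (auto intro: yields.intros)
next
  case (yields_Tm \<beta> w a)
  show ?case
  proof (cases \<gamma>)
    case Nil
    then have "yields G \<gamma> []" "yields G \<delta> (a # w)"
      using yields_Tm by (auto intro: yields.intros)
    then show ?thesis by auto
  next
    case (Cons s \<gamma>')
    then obtain u v where "w = u @ v" "yields G \<gamma>' u" "yields G \<delta> v"
      using yields_Tm by fastforce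
    then have "yields G \<gamma> (a # u)" "a # w = (a # u) @ v"
      using Cons yields_Tm by (auto intro: yields.intros)
    then show ?thesis using \<open>yields G \<delta> v\<close> by blast
  qed
next
  case (yields_Nt A \<alpha> \<beta> w)
  show ?case
  proof (cases \<gamma>)
    case Nil
    then have "yields G \<gamma> []" "yields G \<delta> w"
      using yields_Nt by (auto intro: yields.intros)
    then show ?thesis by auto
  next
    case (Cons s \<gamma>')
    then obtain u v where "w = u @ v" "yields G (\<alpha> @ \<gamma>') u" "yields G \<delta> v"
      using yields_Nt(3)[of "\<alpha> @ \<gamma>'"] yields_Nt(4) by auto
    moreover from this have "yields G \<gamma> u"
      using Cons yields_Nt by (auto intro: yields.intros)
    ultimately show ?thesis by blast
  qed
qed

lemma yields_map_Tm: "yields G (map Tm w) w"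
  by (induction w) (auto intro: yields.intros)

lemma yields_map_TmD: "yields G (map Tm u) w \<Longrightarrow> w = u"
  by (induction "map Tm u :: ('a, 'b) symbol list" w arbitrary: u rule: yields.induct) auto

lemma yields_map_Tm_append: "yields G (map Tm z @ \<gamma>) w \<longleftrightarrow> (\<exists>r. w = z @ r \<and> yields G \<gamma> r)"
  using yields_split[of G "map Tm z" \<gamma> w] yields_append[OF yields_map_Tm, of G \<gamma> _ z] yields_map_TmD
  by metis

lemma derive_step_context:
  "derive_step G x y \<Longrightarrow> derive_step G (u @ x @ v) (u @ y @ v)"
  unfolding derive_step_def by (metis append.assoc)

lemma derives_context: "derives G x y \<Longrightarrow> derives G (u @ x @ v) (u @ y @ v)"
  by (induction rule: rtranclp_induct) (auto intro: rtranclp.rtrancl_into_rtrancl derive_step_context)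

lemma yields_derives: "yields G \<gamma> w \<Longrightarrow> derives G \<gamma> (map Tm w)"
proof (induction rule: yields.induct)
  case (yields_Tm \<gamma> w a)
  then show ?case using derives_context[of G \<gamma> "map Tm w" "[Tm a]" "[]"] by simp
next
  case (yields_Nt A \<alpha> \<gamma> w)
  have "derive_step G (Nt A # \<gamma>) (\<alpha> @ \<gamma>)"
    unfolding derive_step_def using yields_Nt.hyps(1) by (metis append_Cons append_Nil)
  then show ?case using yields_Nt.IH by (rule converse_rtranclp_into_rtranclp)
qed simp

lemma derive_step_yields:
  assumes "derive_step G x y" "yields G y w"
  shows "yields G x w"
proof -
  obtain u A v \<alpha> where A: "(A, \<alpha>) \<in> productions G" "x = u @ [Nt A] @ v" "y = u @ \<alpha> @ v"
    using assms(1) by (auto simp: derive_step_def)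
  obtain w1 w2 where "w = w1 @ w2" "yields G u w1" "yields G (\<alpha> @ v) w2"
    using assms(2) A yields_split[of G u "\<alpha> @ v" w] by auto
  then show ?thesis using A by (auto intro: yields_append yields.intros)
qed

text \<open>\<open>yields\<close> rewrites only the head symbol and emits terminals as it meets
  them, which suits inductions on the derived word; here it is tied to derivations that may rewrite
  anywhere.\<close>

lemma derives_iff_yields: "derives G \<gamma> (map Tm w) \<longleftrightarrow> yields G \<gamma> w"
proof
  assume "derives G \<gamma> (map Tm w)"
  then show "yields G \<gamma> w"
    by (induction rule: converse_rtranclp_induct) (auto intro: yields_map_Tm derive_step_yields)
qed (rule yields_derives)

text \<open>The context \<gamma> enters only through the word it yields, which serves as the
  arbitrary terminal string v in \<open>select\<close>.\<close>

lemma yields_production_select: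
  assumes "yields G (\<alpha> @ \<gamma>) w" "w \<in> lists (alphabet G)"
  shows "take k w \<in> select G k (A, \<alpha>)"
proof -
  obtain u v where w: "w = u @ v" "yields G \<alpha> u" "yields G \<gamma> v"
    using yields_split[OF assms(1)] by blast
  then have "derives G (\<alpha> @ map Tm v) (map Tm w)"
    by (simp only: derives_iff_yields) (auto intro: yields_append yields_map_Tm)
  moreover have "v \<in> lists (alphabet G)" using assms(2) w by auto
  ultimately show ?thesis using assms(2) unfolding select_def snd_conv by blast
qed

text \<open>Truncating an element of a select set for k + 1 gives one for k, so a common lookahead
  of the longer kind would give a common shorter one. This permits assuming k > 0, on which shifting
  the lookahead window by one letter relies.\<close>

lemma LL_Suc:
  assumes "LL k G"
  shows "LL (Suc k) G"
proof -
  have "take k u \<in> select G k p" if u: "u \<in> select G (Suc k) p" for u p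
  proof -
    obtain v w where "v \<in> lists (alphabet G)" "w \<in> lists (alphabet G)"
      "derives G (snd p @ map Tm v) (map Tm w)" "take (Suc k) w = u"
      using u unfolding select_def by blast
    moreover from this have "take k w = take k u" by (auto simp: min_def)
    ultimately show ?thesis unfolding select_def by blast
  qed
  then show ?thesis using assms unfolding LL_def by blast
qed

lemma map_Tm_Nt_unique:
  "map Tm z @ Nt A # \<gamma> = map Tm z' @ Nt A' # \<gamma>' \<longleftrightarrow> z = z' \<and> A = A' \<and> \<gamma> = \<gamma>'"
proof (induction z arbitrary: z')
  case Nil
  then show ?case by (cases z') auto
next
  case (Cons a z)
  then show ?case by (cases z') auto
qed

lemma map_Tm_Nt_neq_map_Tm: "map Tm z @ Nt A # \<gamma> \<noteq> map Tm w"
proof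
  assume "map Tm z @ Nt A # \<gamma> = map Tm w"
  then have "Nt A \<in> set (map Tm w)" by (metis in_set_conv_decomp)
  then show False by auto
qed

section \<open>Leftmost steps chosen by the input\<close>

definition num_terminals :: "('n, 't) symbol list \<Rightarrow> nat" where
  "num_terminals x = length (filter (\<lambda>s. \<exists>a. s = Tm a) x)"

lemma num_simps [simp]:
  "num_terminals [] = 0" "num_terminals (Tm a # x) = Suc (num_terminals x)"
  "num_terminals (Nt A # x) = num_terminals x" "num_terminals (x @ y) = num_terminals x + num_terminals y"
  "num_nonterminals [] = 0" "num_nonterminals (Tm a # x) = num_nonterminals x"
  "num_nonterminals (Nt A # x) = Suc (num_nonterminals x)"
  "num_nonterminals (x @ y) = num_nonterminals x + num_nonterminals y"
  by (simp_all add: num_terminals_def num_nonterminals_def)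

lemma num_map_Tm [simp]: "num_terminals (map Tm z) = length z" "num_nonterminals (map Tm z) = 0"
  by (induction z) auto

lemma num_le_length: "num_terminals x \<le> length x" "num_nonterminals x \<le> length x"
  by (simp_all add: num_terminals_def num_nonterminals_def)

text \<open>The predicted terminals are not compared with \<open>w\<close>: only the lookahead is taken from \<open>w\<close>, at
  the position given by the length of the leading terminal block.\<close>

definition predict :: "('n, 't) cfg \<Rightarrow> nat \<Rightarrow> nat \<Rightarrow> 't list \<Rightarrow>
    ('n, 't) symbol list \<Rightarrow> ('n, 't) symbol list \<Rightarrow> bool" where
  "predict G k b w y y' \<longleftrightarrow> (\<exists>z A \<gamma> \<alpha>. (A, \<alpha>) \<in> productions G \<and>
     y = map Tm z @ Nt A # \<gamma> \<and> y' = map Tm z @ \<alpha> @ \<gamma> \<and>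
     take k (drop (length z) w) \<in> select G k (A, \<alpha>) \<and>
     num_nonterminals y' \<le> b \<and> num_terminals y' \<le> length w)"

lemma LL_unique:
  assumes "LL k G" "(A, \<alpha>) \<in> productions G" "(A, \<beta>) \<in> productions G"
    "u \<in> select G k (A, \<alpha>)" "u \<in> select G k (A, \<beta>)"
  shows "\<alpha> = \<beta>"
  using assms unfolding LL_def by fastforce

text \<open>The lookahead depends only on the input and the length of the leading block, and the
  select sets of rival productions are disjoint.\<close>

lemma predict_deterministic:
  assumes "LL k G" "predict G k b w y y1" "predict G k b w y y2"
  shows "y1 = y2"
  using assms(2,3) LL_unique[OF assms(1)] unfolding predict_def
  by (auto simp: map_Tm_Nt_unique)

lemma predict_map_Tm: "\<not> predict G k b w (map Tm u) y"
  unfolding predict_def using map_Tm_Nt_neq_map_Tm by metis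

lemma predict_leftmost_step: "predict G k b w y y' \<Longrightarrow> leftmost_step G y y'"
  unfolding predict_def leftmost_step_def by force

text \<open>If the form still derives w, its leading block is a prefix of w, and the letters of w
  behind it are exactly the word that the rest has to yield. The limit on terminals holds by itself,
  since terminals of a form survive into the derived word.\<close>

lemma leftmost_step_predict:
  assumes "leftmost_step G y y'" "yields G y' w" "w \<in> lists (alphabet G)"
    "num_nonterminals y' \<le> b"
  shows "predict G k b w y y'"
proof -
  obtain z A v \<alpha> where A: "(A, \<alpha>) \<in> productions G" "y = map Tm z @ Nt A # v" "y' = map Tm z @ \<alpha> @ v"
    using assms(1) by (auto simp: leftmost_step_def)
  obtain r where r: "w = z @ r" "yields G (\<alpha> @ v) r"
    using assms(2) A by (auto simp: yields_map_Tm_append)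
  have "take k r \<in> select G k (A, \<alpha>)"
    using r assms(3) by (intro yields_production_select) auto
  moreover have "num_terminals \<gamma> \<le> length u" if "yields G \<gamma> u" for \<gamma> u
    using that by (induction rule: yields.induct) auto
  then have "num_terminals y' \<le> length w" using assms(2) .
  ultimately show ?thesis unfolding predict_def using A r assms(4) by force
qed

lemma leftmost_step_derive_step: "leftmost_step G x y \<Longrightarrow> derive_step G x y"
  unfolding leftmost_step_def derive_step_def by blast

lemma leftmost_derivation_exists:
  assumes "yields G \<gamma> w"
  shows "\<exists>xs. xs \<noteq> [] \<and> hd xs = map Tm z @ \<gamma> \<and> last xs = map Tm (z @ w) \<and> successively (leftmost_step G) xs"
  using assms
proof (induction arbitrary: z rule: yields.induct)
  case yields_Nil
  then show ?case by (intro exI[of _ "[map Tm z]"]) auto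
next
  case (yields_Tm \<gamma> w a)
  show ?case using yields_Tm.IH[of "z @ [a]"] by simp
next
  case (yields_Nt A \<alpha> \<gamma> w)
  obtain xs where xs: "xs \<noteq> []" "hd xs = map Tm z @ \<alpha> @ \<gamma>" "last xs = map Tm (z @ w)"
    "successively (leftmost_step G) xs"
    using yields_Nt.IH by blast
  have "leftmost_step G (map Tm z @ Nt A # \<gamma>) (hd xs)"
    unfolding leftmost_step_def using yields_Nt.hyps(1) xs(2) by force
  then show ?case using xs
    by (intro exI[of _ "(map Tm z @ Nt A # \<gamma>) # xs"]) (auto simp: successively_Cons)
qed

lemma successively_rtranclp_last:
  "successively R xs \<Longrightarrow> y \<in> set xs \<Longrightarrow> R\<^sup>*\<^sup>* y (last xs)"
proof (induction xs arbitrary: y)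
  case (Cons x xs)
  show ?case
  proof (cases "xs = []")
    case False
    then have R: "R x (hd xs)" "successively R xs" using Cons.prems by (auto simp: successively_Cons)
    from False have "R\<^sup>*\<^sup>* (hd xs) (last xs)" using Cons.IH R by auto
    then have "R\<^sup>*\<^sup>* x (last xs)" using R by (meson converse_rtranclp_into_rtranclp)
    then show ?thesis using Cons R False by auto
  qed (use Cons in auto)
qed auto

lemma leftmost_derivation_yields:
  assumes "leftmost_derivation G w xs" "y \<in> set xs"
  shows "yields G y w"
proof -
  have "(leftmost_step G)\<^sup>*\<^sup>* y (map Tm w)"
    using assms successively_rtranclp_last[of "leftmost_step G" xs y] by (auto simp: leftmost_derivation_def)
  then have "derives G y (map Tm w)"
    by (induction rule: rtranclp_induct) (auto dest: leftmost_step_derive_step)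
  then show ?thesis by (simp add: derives_iff_yields)
qed

lemma successively_leftmost_predict:
  assumes "successively (leftmost_step G) xs" "\<And>y. y \<in> set xs \<Longrightarrow> yields G y w \<and> num_nonterminals y \<le> b"
    "w \<in> lists (alphabet G)"
  shows "successively (predict G k b w) xs"
  using assms(1,2)
  by (induction xs rule: induct_list012) (auto intro!: leftmost_step_predict assms(3))

text \<open>Neither sequence can be a proper prefix of the other, because both end at the same stuck
  element.\<close>

lemma successively_deterministic_unique:
  assumes "\<And>x y z. R x y \<Longrightarrow> R x z \<Longrightarrow> y = z" "\<And>y. \<not> R t y"
  shows "successively R xs \<Longrightarrow> successively R ys \<Longrightarrow> xs \<noteq> [] \<Longrightarrow> ys \<noteq> [] \<Longrightarrow> hd xs = hd ys \<Longrightarrow>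
    last xs = t \<Longrightarrow> last ys = t \<Longrightarrow> xs = ys"
proof (induction xs arbitrary: ys)
  case (Cons x xs)
  obtain ys' where ys: "ys = x # ys'" using Cons.prems by (cases ys) auto
  show ?case
  proof (cases "xs = [] \<or> ys' = []")
    case True
    then show ?thesis using Cons.prems ys assms(2)
      by (auto simp: successively_Cons split: if_splits)
  next
    case False
    then show ?thesis using Cons.IH[of ys'] Cons.prems ys assms(1)
      by (auto simp: successively_Cons)
  qed
qed auto

text \<open>Gives the description operator in \<open>grammar_rank\<close> its intended value.
  Leftmost steps in general are not deterministic, but those leading to w are predictions, and
  predictions are.\<close>

lemma leftmost_derivation_unique:
  assumes "LL k G" "w \<in> lists (alphabet G)" "leftmost_derivation G w xs" "leftmost_derivation G w ys"
  shows "xs = ys"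
proof -
  \<comment> \<open>A cap large enough for both derivations, so that the limit on nonterminals in
    \<open>predict\<close> never interferes.\<close>
  define b where "b = Max (insert 0 (num_nonterminals ` (set xs \<union> set ys)))"
  have "num_nonterminals y \<le> b" if "y \<in> set xs \<union> set ys" for y
    unfolding b_def using that by (intro Max_ge) auto
  then have "successively (predict G k b w) xs" "successively (predict G k b w) ys"
    using assms leftmost_derivation_yields[OF assms(3)] leftmost_derivation_yields[OF assms(4)]
    by (auto intro!: successively_leftmost_predict simp: leftmost_derivation_def)
  then show ?thesis
    using assms(3,4) predict_deterministic[OF assms(1)] predict_map_Tm
      successively_deterministic_unique[of "predict G k b w" "map Tm w" xs ys]
    unfolding leftmost_derivation_def by metis
qed

lemma grammar_rank_eq:
  assumes "LL k G" "w \<in> lists (alphabet G)" "leftmost_derivation G w xs"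
  shows "grammar_rank G w = Max (num_nonterminals ` set xs)"
proof -
  have "(THE xs. leftmost_derivation G w xs) = xs"
    using leftmost_derivation_unique[OF assms(1,2)] assms(3) by (intro the_equality) auto
  then show ?thesis by (simp add: grammar_rank_def)
qed

text \<open>The cap in \<open>predict\<close> is respected along the unique leftmost derivation
  exactly if the rank is at most b. Since \<open>predict\<close> checks only successor forms, the
  start form with its one nonterminal is covered by b > 0.\<close>

lemma predict_iff_lang_rank:
  assumes "LL k G" "w \<in> lists (alphabet G)" "b > 0"
  shows "(predict G k b w)\<^sup>*\<^sup>* [Nt (start G)] (map Tm w) \<longleftrightarrow> w \<in> lang G \<and> grammar_rank G w \<le> b"
    (is "?L \<longleftrightarrow> ?R")
proof
  assume ?R
  then have "yields G [Nt (start G)] w"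
    using derives_iff_yields by (auto simp: lang_def)
  from leftmost_derivation_exists[OF this, of "[]"]
  obtain xs where xs: "leftmost_derivation G w xs" by (auto simp: leftmost_derivation_def)
  have "num_nonterminals y \<le> b" if "y \<in> set xs" for y
    using \<open>?R\<close> that Max_ge[of "num_nonterminals ` set xs" "num_nonterminals y"]
    unfolding grammar_rank_eq[OF assms(1,2) xs] by (meson List.finite_set finite_imageI imageI order_trans)
  then have "successively (predict G k b w) xs"
    using assms xs leftmost_derivation_yields[OF xs]
    by (auto intro!: successively_leftmost_predict simp: leftmost_derivation_def)
  then show ?L
    using xs successively_rtranclp_last[of "predict G k b w" xs "hd xs"] hd_in_set[of xs]
    by (simp add: leftmost_derivation_def)
next
  assume ?L
  then have "\<exists>xs. xs \<noteq> [] \<and> hd xs = [Nt (start G)] \<and> last xs = map Tm w \<and>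
      successively (leftmost_step G) xs \<and> (\<forall>y \<in> set xs. num_nonterminals y \<le> b)"
  proof (induction rule: rtranclp_induct)
    case base
    then show ?case using assms(3) by (intro exI[of _ "[[Nt (start G)]]"]) auto
  next
    case (step y z)
    then obtain xs where xs: "xs \<noteq> []" "hd xs = [Nt (start G)]" "last xs = y"
      "successively (leftmost_step G) xs" "\<forall>y \<in> set xs. num_nonterminals y \<le> b" by blast
    moreover have "leftmost_step G y z" "num_nonterminals z \<le> b"
      using predict_leftmost_step[OF step.hyps(2)] step.hyps(2) by (auto simp: predict_def)
    ultimately show ?case
      by (intro exI[of _ "xs @ [z]"]) (auto simp: successively_append_iff)
  qed
  then obtain xs where xs: "leftmost_derivation G w xs" "\<forall>y \<in> set xs. num_nonterminals y \<le> b" "xs \<noteq> []"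
    by (auto simp: leftmost_derivation_def)
  have "hd xs \<in> set xs" "hd xs = [Nt (start G)]"
    using xs hd_in_set[OF xs(3)] by (auto simp: leftmost_derivation_def)
  then have "yields G [Nt (start G)] w"
    using leftmost_derivation_yields[OF xs(1), of "hd xs"] by simp
  then have "w \<in> lang G"
    using assms(2) by (auto simp: lang_def derives_iff_yields)
  then show ?R using xs by (auto simp: grammar_rank_eq[OF assms(1,2) xs(1)])
qed

section \<open>Shapes of sentential forms and the length of a successful parse\<close>

fun shape_push :: "('n, 't) symbol \<Rightarrow> nat \<times> ('n \<times> nat) list \<Rightarrow> nat \<times> ('n \<times> nat) list" where
  "shape_push (Tm a) (l, S) = (Suc l, S)"
| "shape_push (Nt A) (l, S) = (0, (A, l) # S)"

text \<open>What the control flow sees of a form: the length of the leading block and, for each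
  nonterminal, the length of the block behind it. Forgetting the letters keeps the number of shapes
  within the limits at n to the power O(b).\<close>

definition shape :: "('n, 't) symbol list \<Rightarrow> nat \<times> ('n \<times> nat) list" where
  "shape y = foldr shape_push y (0, [])"

lemma shape_append: "shape (x @ y) = foldr shape_push x (shape y)"
  by (simp add: shape_def)

lemma foldr_shape_push_map_Tm: "foldr shape_push (map Tm z) (l, S) = (length z + l, S)"
  by (induction z) auto

lemma shape_map_Tm: "shape (map Tm w) = (length w, [])"
  by (simp add: shape_def foldr_shape_push_map_Tm)

lemma shape_map_Tm_Nt:
  "shape (map Tm z @ Nt A # \<gamma>) = (length z, (A, fst (shape \<gamma>)) # snd (shape \<gamma>))"
proof -
  have "shape (Nt A # \<gamma>) = (0, (A, fst (shape \<gamma>)) # snd (shape \<gamma>))"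
    by (cases "shape \<gamma>") (simp add: shape_def)
  then show ?thesis by (simp add: shape_append foldr_shape_push_map_Tm)
qed

lemma shape_bounds:
  assumes "set y \<subseteq> Nt ` N \<union> Tm ` T"
  shows "fst (shape y) \<le> num_terminals y \<and> length (snd (shape y)) = num_nonterminals y \<and>
    set (snd (shape y)) \<subseteq> N \<times> {..num_terminals y}"
  using assms
proof (induction y)
  case (Cons s y)
  then show ?case
    by (cases "shape y"; cases s) (force simp: shape_def)+
qed (simp add: shape_def)

text \<open>The production is determined by the top nonterminal and the letters at the current
  position, both fixed by the shape, and pushing the same right-hand side changes equal shapes
  equally.\<close>

lemma predict_shape:
  assumes "LL k G" "predict G k b w x x'" "predict G k b w y y'" "shape x = shape y"
  shows "shape x' = shape y'"
proof -
  obtain z A \<gamma> \<alpha> where x: "(A, \<alpha>) \<in> productions G" "x = map Tm z @ Nt A # \<gamma>" "x' = map Tm z @ \<alpha> @ \<gamma>"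
    "take k (drop (length z) w) \<in> select G k (A, \<alpha>)"
    using assms(2) unfolding predict_def by blast
  obtain z2 A2 \<gamma>2 \<alpha>2 where y: "(A2, \<alpha>2) \<in> productions G" "y = map Tm z2 @ Nt A2 # \<gamma>2"
    "y' = map Tm z2 @ \<alpha>2 @ \<gamma>2" "take k (drop (length z2) w) \<in> select G k (A2, \<alpha>2)"
    using assms(3) unfolding predict_def by blast
  have eq: "length z2 = length z" "A2 = A" "shape \<gamma>2 = shape \<gamma>"
    using assms(4) x(2) y(2) by (auto simp: shape_map_Tm_Nt prod_eq_iff)
  then have "\<alpha>2 = \<alpha>" using LL_unique[OF assms(1)] x y by metis
  then show ?thesis using x(3) y(3) eq
    by (cases "foldr shape_push \<alpha> (shape \<gamma>)") (simp add: shape_append foldr_shape_push_map_Tm)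
qed

lemma predict_symbols:
  assumes "wf_cfg G" "predict G k b w y y'" "set y \<subseteq> Nt ` nonterminals G \<union> Tm ` alphabet G"
  shows "set y' \<subseteq> Nt ` nonterminals G \<union> Tm ` alphabet G"
proof -
  obtain z A \<gamma> \<alpha> where A: "(A, \<alpha>) \<in> productions G" "y = map Tm z @ Nt A # \<gamma>" "y' = map Tm z @ \<alpha> @ \<gamma>"
    using assms(2) unfolding predict_def by blast
  have "set \<alpha> \<subseteq> Nt ` nonterminals G \<union> Tm ` alphabet G"
    using assms(1) A(1) unfolding wf_cfg_def by blast
  then show ?thesis using assms(3) A by simp
qed

lemma deterministic_relpow_stuck_le:
  fixes i j :: nat
  assumes "\<And>x y z. R x y \<Longrightarrow> R x z \<Longrightarrow> y = z" "\<And>y. \<not> R t y" "(R ^^ i) x y" "(R ^^ j) x t"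
  shows "i \<le> j"
  using assms(3,4)
proof (induction j arbitrary: x i)
  case 0
  show ?case
  proof (cases i)
    case (Suc i')
    then obtain x' where "R x x'" using relpowp_Suc_D2 0 by metis
    then show ?thesis using 0 assms(2) by auto
  qed simp
next
  case (Suc j)
  then obtain x' where x': "R x x'" "(R ^^ j) x' t" by (metis relpowp_Suc_D2)
  show ?case
  proof (cases i)
    case (Suc i')
    then obtain x2 where "R x x2" "(R ^^ i') x2 y" using Suc.prems by (metis relpowp_Suc_D2)
    then have "(R ^^ i') x' y" using x' assms(1) by metis
    then show ?thesis using Suc.IH x' Suc by auto
  qed simp
qed

lemma deterministic_rtranclp_stuck:
  assumes "\<And>x y z. R x y \<Longrightarrow> R x z \<Longrightarrow> y = z" "\<And>y. \<not> R t y" "R\<^sup>*\<^sup>* x y" "R\<^sup>*\<^sup>* x t"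
  shows "R\<^sup>*\<^sup>* y t"
  using assms(3,4)
proof (induction rule: rtranclp_induct)
  case (step y z)
  then have "R\<^sup>*\<^sup>* y t" "y \<noteq> t" using assms(2) by auto
  then show ?case using step.hyps(2) assms(1) by (metis converse_rtranclpE)
qed auto

text \<open>Shapes determine the shapes of all later sentential forms, so a terminating run repeats none.\<close>

lemma predict_length_bound:
  assumes wf: "wf_cfg G" and LL: "LL k G" and b: "b > 0"
    and fin: "(predict G k b w)\<^sup>*\<^sup>* [Nt (start G)] (map Tm w)"
    and y: "(predict G k b w ^^ i) [Nt (start G)] y"
  shows "i < Suc (length w) * (Suc (card (nonterminals G) * Suc (length w))) ^ b"
proof -
  define R where "R = predict G k b w"
  define D where "D = nonterminals G \<times> {..length w}"
  define X where "X = {..length w} \<times> {xs. set xs \<subseteq> D \<and> length xs \<le> b}"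
  obtain j where j: "(R ^^ j) [Nt (start G)] (map Tm w)"
    using fin unfolding R_def by (auto dest: rtranclp_imp_relpowp)
  have det: "u = v" if "R t u" "R t v" for t u v
    using that unfolding R_def by (rule predict_deterministic[OF LL])
  have ij: "i \<le> j"
  proof (rule deterministic_relpow_stuck_le[of R "map Tm w"])
    show "\<not> R (map Tm w) y" for y unfolding R_def by (rule predict_map_Tm)
    show "(R ^^ i) [Nt (start G)] y" using y by (simp add: R_def)
  qed (rule det j; assumption)+
  obtain f where f: "f 0 = [Nt (start G)]" "f j = map Tm w" "\<And>l. l < j \<Longrightarrow> R (f l) (f (Suc l))"
    using j unfolding relpowp_fun_conv by blast
  have finD: "finite D" using wf by (auto simp: D_def wf_cfg_def)
  have sym: "set (f l) \<subseteq> Nt ` nonterminals G \<union> Tm ` alphabet G" if "l \<le> j" for l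
    using that
  proof (induction l)
    case 0
    then show ?case using wf f by (auto simp: wf_cfg_def)
  next
    case (Suc l)
    then have "predict G k b w (f l) (f (Suc l))" using f(3)[of l] by (simp add: R_def)
    from predict_symbols[OF wf this] show ?case using Suc by simp
  qed
  have bnd: "num_nonterminals (f l) \<le> b \<and> num_terminals (f l) \<le> length w" if "l \<le> j" for l
  proof (cases l)
    case 0
    then show ?thesis using f(1) b by simp
  next
    case (Suc l')
    then have "predict G k b w (f l') (f l)" using f(3)[of l'] that by (simp add: R_def)
    then show ?thesis unfolding predict_def by blast
  qed
  have "shape (f l) \<in> X" if "l \<le> j" for l
  proof -
    note shape = shape_bounds[OF sym[OF that]]
    have "{..num_terminals (f l)} \<subseteq> {..length w}" using bnd[OF that] by simp
    then have "nonterminals G \<times> {..num_terminals (f l)} \<subseteq> D"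
      unfolding D_def by (rule Sigma_mono[OF order_refl])
    with shape have "set (snd (shape (f l))) \<subseteq> D" by (meson order_trans)
    then show ?thesis
      using shape bnd[OF that] by (simp add: X_def mem_Times_iff)
  qed
  then have sub: "(shape \<circ> f) ` {..j} \<subseteq> X" by auto
  \<comment> \<open>If the shapes at l < m agreed, so would those d steps later. With d = j - m, the
    form at l + (j - m) < j would have the shape of w, which has no nonterminal, yet this form can
    still be rewritten.\<close>
  have "False" if "l < m" "m \<le> j" "shape (f l) = shape (f m)" for l m
  proof -
    have "shape (f (l + d)) = shape (f (m + d))" if "m + d \<le> j" for d
      using that
    proof (induction d)
      case (Suc d)
      have "predict G k b w (f (l + d)) (f (l + Suc d))" "predict G k b w (f (m + d)) (f (m + Suc d))"
        using f(3)[of "l + d"] f(3)[of "m + d"] \<open>l < m\<close> Suc.prems by (simp_all add: R_def)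
      moreover have "shape (f (l + d)) = shape (f (m + d))" using Suc by simp
      ultimately show ?case by (rule predict_shape[OF LL])
    qed (use \<open>shape (f l) = shape (f m)\<close> in auto)
    from this[of "j - m"] have "shape (f (l + (j - m))) = shape (map Tm w)"
      using \<open>m \<le> j\<close> f(2) by simp
    moreover have "predict G k b w (f (l + (j - m))) (f (Suc (l + (j - m))))"
      using that f(3)[of "l + (j - m)"] by (simp add: R_def)
    then obtain z A \<gamma> where "f (l + (j - m)) = map Tm z @ Nt A # \<gamma>"
      unfolding predict_def by blast
    ultimately show False by (simp add: shape_map_Tm shape_map_Tm_Nt)
  qed
  then have "inj_on (shape \<circ> f) {..j}"
    by (intro inj_onI) (metis atMost_iff comp_apply linorder_neqE_nat)
  moreover have "finite X" unfolding X_def using finD by (intro finite_cartesian_product finite_lists_length_le) auto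
  ultimately have "card {..j} \<le> card X" using sub by (meson card_inj_on_le)
  \<comment> \<open>The sum counts the lists of length at most b over c elements; padding them with
    one extra symbol explains the bound.\<close>
  moreover have "(\<Sum>l\<le>b. c ^ l) \<le> Suc c ^ b" for c :: nat
  proof (induction b)
    case (Suc b)
    have "(\<Sum>l\<le>Suc b. c ^ l) \<le> Suc c ^ b + c * c ^ b" using Suc by simp
    also have "\<dots> \<le> Suc c ^ b + c * Suc c ^ b" by (intro add_left_mono mult_left_mono power_mono) auto
    finally show ?case by simp
  qed simp
  then have "card X \<le> Suc (length w) * Suc (card D) ^ b"
    using finD by (simp add: X_def card_cartesian_product card_lists_length_le del: mult_Suc)
  moreover have "card D = card (nonterminals G) * Suc (length w)"
    by (simp add: D_def card_cartesian_product)
  ultimately show ?thesis using ij by simp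
qed

section \<open>Primes and roots of polynomials modulo primes\<close>

text \<open>The Leibniz triangle bounds the least common multiple of \<open>1, \<dots>, 2 m\<close> from below by a
  binomial coefficient, without any \<open>p\<close>-adic valuation of factorials.\<close>

lemma leibniz_triangle:
  assumes "Suc m \<le> n"
  shows "1 / (real (Suc (Suc m)) * real (Suc n choose Suc (Suc m))) =
    1 / (real (Suc m) * real (n choose Suc m)) - 1 / (real (Suc m) * real (Suc n choose Suc m))"
proof -
  have 1: "real (Suc (Suc m)) * real (Suc n choose Suc (Suc m)) = real (Suc n) * real (n choose Suc m)"
    by (metis Suc_times_binomial_eq mult.commute of_nat_mult)
  have 2: "real (Suc m) * real (Suc n choose Suc m) = real (Suc n) * real (n choose m)"
    by (metis Suc_times_binomial_eq mult.commute of_nat_mult)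
  have 3: "real (Suc m) * real (n choose Suc m) = real (n - m) * real (n choose m)"
    by (metis binomial_absorb_comp binomial_absorption mult.commute of_nat_mult)
  have pos: "real (n choose m) > 0" "real (n choose Suc m) > 0" "real (n - m) > 0"
    using assms by (auto simp: zero_less_binomial_iff)
  have n: "real (n - m) = real n - real m" using assms by simp
  have 4: "real (n choose Suc m) = real (n - m) * real (n choose m) / real (Suc m)"
    using 3 by (simp add: field_simps)
  show ?thesis
    unfolding 1 2 3 unfolding 4 n using pos n by (simp add: divide_simps)
qed

text \<open>Each entry of the Leibniz triangle is the difference of the entries of the previous
  column in rows n - 1 and n, and the first column consists of the 1/n. So multiplying by the Lcm
  gives an integer, by induction on the column with the row left arbitrary.\<close>

lemma binomial_dvd_Lcm:
  assumes "m < n"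
  shows "Suc m * (n choose Suc m) dvd Lcm {1..n}"
proof -
  define L where "L n = Lcm {1..n::nat}" for n
  have "real (L n) / (real (Suc m) * real (n choose Suc m)) \<in> \<int>"
    using assms
  proof (induction m arbitrary: n)
    case 0
    have "n dvd L n" unfolding L_def using 0 by (intro dvd_Lcm) auto
    then show ?case using 0 by (auto elim!: dvdE)
  next
    case (Suc m)
    then obtain n' where n: "n = Suc n'" by (cases n) auto
    have "L n' dvd L n" unfolding L_def n by (rule Lcm_subset) auto
    then obtain c where c: "L n = L n' * c" by (elim dvdE)
    have "real (L n') / (real (Suc m) * real (n' choose Suc m)) \<in> \<int>"
      "real (L n) / (real (Suc m) * real (n choose Suc m)) \<in> \<int>"
      using Suc.IH[of n'] Suc.IH[of n] Suc.prems unfolding n by (auto simp del: binomial_Suc_Suc of_nat_Suc)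
    then have "real c * (real (L n') / (real (Suc m) * real (n' choose Suc m))) -
        real (L n) / (real (Suc m) * real (n choose Suc m)) \<in> \<int>"
      by (intro Ints_diff Ints_mult) auto
    moreover have "real (L n) / (real (Suc (Suc m)) * real (n choose Suc (Suc m))) =
        real (L n) * (1 / (real (Suc m) * real (n' choose Suc m)) - 1 / (real (Suc m) * real (n choose Suc m)))"
    proof -
      have le: "Suc m \<le> n'" using Suc.prems n by simp
      show ?thesis unfolding n leibniz_triangle[OF le, symmetric] by simp
    qed
    ultimately show ?case by (simp add: c right_diff_distrib mult.commute mult.left_commute)
  qed
  then obtain i where "real (L n) / (real (Suc m) * real (n choose Suc m)) = of_int i"
    by (elim Ints_cases)
  moreover have "real (Suc m) * real (n choose Suc m) > 0"
    using assms by (simp add: zero_less_binomial_iff)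
  ultimately have "real (L n) = of_int i * real (Suc m * (n choose Suc m))"
    by (simp add: field_simps del: mult_Suc)
  then have "int (L n) = i * int (Suc m * (n choose Suc m))"
    by (metis of_int_eq_iff of_int_mult of_int_of_nat_eq)
  then have "int (Suc m * (n choose Suc m)) dvd int (L n)" by simp
  then show ?thesis unfolding L_def by (simp only: int_dvd_int_iff)
qed

text \<open>Each maximal prime power dividing the Lcm is at most M, and there are at most N of these
  primes because the primes themselves are at most N.\<close>

lemma Lcm_le_power:
  assumes "M > 0" "\<And>p. prime p \<Longrightarrow> p \<le> M \<Longrightarrow> p \<le> N"
  shows "Lcm {1..M} \<le> M ^ N"
proof -
  define L where "L = Lcm {1..M}"
  have L: "L \<noteq> 0" unfolding L_def by (subst Lcm_0_iff) auto
  have pf: "p \<le> N \<and> p \<ge> 1 \<and> p ^ multiplicity p L \<le> M" if p: "p \<in> prime_factors L" for p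
  proof -
    have "prime p" using p by auto
    define e where "e = multiplicity p L"
    have "e > 0" using p by (simp add: e_def prime_factors_multiplicity)
    \<comment> \<open>Otherwise every j in the range contains p at most e - 1 times, and the Lcm
      divided by p would be a smaller common multiple.\<close>
    have "\<exists>j \<in> {1..M}. p ^ e dvd j"
    proof (rule ccontr)
      assume no: "\<not> (\<exists>j \<in> {1..M}. p ^ e dvd j)"
      obtain d where d: "L = p ^ e * d" unfolding e_def by (meson dvdE multiplicity_dvd)
      obtain e' where e': "e = Suc e'" using \<open>e > 0\<close> by (cases e) auto
      have "j dvd p ^ e' * d" if "j \<in> {1..M}" for j
      proof -
        have "j \<noteq> 0" using that by auto
        have "\<not> p ^ e dvd j" using no that by auto
        then have "multiplicity p j \<le> e'"
          using \<open>prime p\<close> \<open>j \<noteq> 0\<close> e' by (metis not_less_eq_eq multiplicity_dvd')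
        obtain c where c: "j = p ^ multiplicity p j * c" "\<not> p dvd c"
          using multiplicity_decompose'[of j p] \<open>prime p\<close> \<open>j \<noteq> 0\<close> by (metis not_prime_unit)
        have "j dvd L" unfolding L_def using that by (rule dvd_Lcm)
        then have "c dvd p ^ e * d" using c d by (metis dvd_mult_right)
        moreover have "coprime c (p ^ e)" using c \<open>prime p\<close>
          by (metis coprime_commute coprime_power_left_iff prime_imp_coprime)
        ultimately have "c dvd d" using coprime_dvd_mult_right_iff by blast
        moreover have "p ^ multiplicity p j dvd p ^ e'"
          using \<open>multiplicity p j \<le> e'\<close> by (rule le_imp_power_dvd)
        ultimately show ?thesis using c(1) by (metis mult_dvd_mono)
      qed
      then have "L dvd p ^ e' * d" unfolding L_def by (rule Lcm_least)
      then have "L \<le> p ^ e' * d" using L d e' by (intro dvd_imp_le) auto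
      moreover have "L = p * (p ^ e' * d)" using d e' by simp
      ultimately show False using L \<open>prime p\<close> prime_gt_1_nat[of p] by auto
    qed
    then obtain j where j: "j \<in> {1..M}" "p ^ e dvd j" by blast
    then have "p ^ e \<le> M" using dvd_imp_le[of "p ^ e" j] by auto
    moreover have "p dvd j" using j(2) \<open>e > 0\<close> by (meson dvd_power dvd_trans)
    then have "p \<le> M" using j(1) dvd_imp_le[of p j] by auto
    ultimately show ?thesis using assms(2)[of p] \<open>prime p\<close> prime_ge_1_nat[of p] by (simp add: e_def)
  qed
  have "L = (\<Prod>p \<in> prime_factors L. p ^ multiplicity p L)"
    using L by (simp add: prime_factorization_nat)
  also have "\<dots> \<le> (\<Prod>p \<in> prime_factors L. M)"
    using pf by (intro prod_mono) auto
  also have "\<dots> = M ^ card (prime_factors L)" by simp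
  also have "\<dots> \<le> M ^ N"
  proof (rule power_increasing)
    have "prime_factors L \<subseteq> {1..N}" using pf by auto
    then show "card (prime_factors L) \<le> N" using card_mono[of "{1..N}"] by fastforce
  qed (use assms in simp)
  finally show ?thesis unfolding L_def .
qed

text \<open>Without a prime in this interval all primes up to 16 N^2 are at most N, so the Lcm of 1,
  ..., 16 N^2 is at most (16 N^2)^N, while the central binomial coefficient forces it to be at least
  2^(8 N^2).\<close>

lemma exists_prime_le_square:
  assumes "N > 0"
  shows "\<exists>p::nat. prime p \<and> N < p \<and> p \<le> 16 * N ^ 2"
proof (rule ccontr)
  assume no: "\<not> ?thesis"
  define m where "m = 8 * N ^ 2"
  have m: "m > 0" using assms by (simp add: m_def)
  have "2 ^ m \<le> (2 * m) choose m"
  proof -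
    \<comment> \<open>Passing from j to j + 1 multiplies the binomial coefficient by (m + j + 1) /
      (j + 1), which is at least 2 as long as j + 1 <= m.\<close>
    have "2 ^ j * 1 \<le> (m + j) choose j" if "j \<le> m" for j
      using that
    proof (induction j)
      case (Suc j)
      have "Suc j * ((m + Suc j) choose Suc j) = (m + Suc j) * ((m + j) choose j)"
        using Suc_times_binomial_eq[of "m + j" j] by (simp add: mult.commute)
      moreover have "Suc j * 2 * ((m + j) choose j) \<le> (m + Suc j) * ((m + j) choose j)"
        using Suc.prems by (intro mult_right_mono) auto
      ultimately have "Suc j * (2 * ((m + j) choose j)) \<le> Suc j * ((m + Suc j) choose Suc j)" by simp
      then have "2 * ((m + j) choose j) \<le> (m + Suc j) choose Suc j"
        by (simp only: mult_le_cancel1)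
      moreover have "2 ^ j \<le> (m + j) choose j" using Suc by simp
      ultimately show ?case by simp
    qed simp
    from this[of m] show ?thesis by (simp add: mult_2)
  qed
  also have "\<dots> \<le> Lcm {1..2 * m}"
  proof (rule dvd_imp_le)
    have "Suc (m - 1) * (2 * m choose Suc (m - 1)) dvd Lcm {1..2 * m}"
      using m by (intro binomial_dvd_Lcm) auto
    then show "(2 * m) choose m dvd Lcm {1..2 * m}" using m by (auto dest: dvd_mult_right)
  qed (simp add: Lcm_0_iff neq0_conv[symmetric] del: neq0_conv)
  also have "\<dots> \<le> (2 * m) ^ N"
  proof (rule Lcm_le_power)
    show "q \<le> N" if "prime q" "q \<le> 2 * m" for q
      using no that by (auto simp: m_def not_less)
  qed (use m in simp)
  also have "\<dots> < (2 ^ (4 + 2 * N)) ^ N"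
  proof (rule power_strict_mono)
    have "N * N < 2 ^ N * 2 ^ N" by (intro mult_strict_mono less_exp) auto
    then have "2 * m < 16 * (2 ^ N * 2 ^ N)" by (simp add: m_def power2_eq_square)
    also have "\<dots> = 2 ^ (4 + 2 * N)" by (simp only: power_add mult_2) simp
    finally show "2 * m < 2 ^ (4 + 2 * N)" .
  qed (use assms in auto)
  also have "\<dots> \<le> 2 ^ m"
  proof -
    have "(4 + 2 * N) * N \<le> (8 * N) * N" using assms by (intro mult_right_mono) auto
    then have "(4 + 2 * N) * N \<le> m" by (simp add: m_def power2_eq_square)
    then show ?thesis by (simp only: power_mult[symmetric] power_increasing)
  qed
  finally show False by simp
qed

text \<open>Lagrange's bound over the field with p elements, phrased for integer polynomials to
  avoid passing to the quotient: p not dividing f stands for f being nonzero modulo p. A root splits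
  off a linear factor up to a constant divisible by p, and primality makes every other root one of
  the cofactor.\<close>

lemma card_roots_mod_prime:
  fixes f :: "int poly"
  assumes p: "prime p" and f: "\<not> [:p:] dvd f"
  shows "card {x \<in> {0..<p}. p dvd poly f x} \<le> degree f"
  using f
proof (induction "degree f" arbitrary: f)
  case 0
  then obtain c where c: "f = [:c:]" by (metis degree_eq_zeroE)
  then have "\<not> p dvd c" using 0 by (metis const_poly_dvd_iff coeff_pCons_0 coeff_pCons_Suc dvd_0_right coeff_0 not0_implies_Suc)
  then have "{x \<in> {0..<p}. p dvd poly f x} = {}" using c by auto
  then show ?case by (simp only: card.empty)
next
  case (Suc d)
  show ?case
  proof (cases "{x \<in> {0..<p}. p dvd poly f x} = {}")
    case False
    then obtain a where a: "a \<in> {0..<p}" "p dvd poly f a" by blast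
    define g where "g = synthetic_div f a"
    have fg: "f = [:-a, 1:] * g + [:poly f a:]" unfolding g_def by (rule synthetic_div_correct'[symmetric])
    have "[:p:] dvd [:poly f a:]" using a(2) by (simp add: const_poly_dvd_iff coeff_pCons split: nat.split)
    then have "\<not> [:p:] dvd g" using Suc.prems fg by (metis dvd_add dvd_mult)
    moreover have dg: "d = degree g" using Suc.hyps(2) by (simp add: g_def degree_synthetic_div)
    ultimately have IH: "card {x \<in> {0..<p}. p dvd poly g x} \<le> d" using Suc.hyps(1) by blast
    have "{x \<in> {0..<p}. p dvd poly f x} \<subseteq> insert a {x \<in> {0..<p}. p dvd poly g x}"
    proof
      fix x assume x: "x \<in> {x \<in> {0..<p}. p dvd poly f x}"
      have "poly f x = poly ([:-a, 1:] * g + [:poly f a:]) x" using fg by (rule arg_cong)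
      also have "\<dots> = (x - a) * poly g x + poly f a" by (simp add: algebra_simps)
      finally have "poly f x = (x - a) * poly g x + poly f a" .
      then have "p dvd (x - a) * poly g x" using x a(2) by (metis dvd_add_left_iff mem_Collect_eq)
      then consider "p dvd x - a" | "p dvd poly g x" using p prime_dvd_mult_iff by blast
      then show "x \<in> insert a {x \<in> {0..<p}. p dvd poly g x}"
      proof cases
        case 1
        then have "x mod p = a mod p" by (simp add: mod_eq_dvd_iff)
        then show ?thesis using x a by simp
      qed (use x in simp)
    qed
    then have "card {x \<in> {0..<p}. p dvd poly f x} \<le> card (insert a {x \<in> {0..<p}. p dvd poly g x})"
      by (rule card_mono[rotated]) (simp, rule finite_subset[of _ "{0..<p}"], auto)
    also have "\<dots> \<le> Suc (card {x \<in> {0..<p}. p dvd poly g x})"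
      by (rule card_insert_le_m1) simp_all
    also have "\<dots> \<le> Suc d" using IH by (simp only: Suc_le_mono)
    finally show ?thesis using Suc.hyps(2) by simp
  qed (simp only: card.empty)
qed

section \<open>Collisions of polynomial fingerprints\<close>

lemma poly_Poly_horner_sum: "poly (Poly (map (\<lambda>a. int (e a)) z)) (int x) = int (horner_sum e x z)"
  by (induction z) simp_all

lemma degree_Poly_less: "xs \<noteq> [] \<Longrightarrow> degree (Poly xs) < length xs"
proof (induction xs)
  case (Cons x xs)
  then show ?case by (cases "xs = []") (auto simp: degree_pCons_eq_if)
qed simp

text \<open>Where u and v differ, their codes differ and are below p, so the difference polynomial
  has a coefficient that p does not divide. The inequality is strict because n coefficients give
  degree at most n - 1.\<close>

lemma card_hash_collisions:
  fixes e :: "'a \<Rightarrow> nat" and p :: nat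
  assumes p: "prime p" and inj: "inj_on e S" and e: "\<And>a. a \<in> S \<Longrightarrow> e a < p"
    and S: "set u \<subseteq> S" "set v \<subseteq> S" and len: "length u = length v" and ne: "u \<noteq> v"
  shows "card {x. x < p \<and> horner_sum e x u mod p = horner_sum e x v mod p} < length u"
proof -
  define P where "P w = Poly (map (\<lambda>a. int (e a)) w)" for w
  define f where "f = P u - P v"
  have u: "u \<noteq> []" "v \<noteq> []" using len ne by auto
  have "\<not> [:int p:] dvd f"
  proof
    assume "[:int p:] dvd f"
    then have dvd: "int p dvd coeff f i" for i by (simp add: const_poly_dvd_iff)
    have "u ! i = v ! i" if i: "i < length u" for i
    proof -
      have "int p dvd int (e (u ! i)) - int (e (v ! i))"
        using dvd[of i] i len by (simp add: f_def P_def coeff_Poly_eq nth_default_def)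
      then have "int (e (u ! i)) mod int p = int (e (v ! i)) mod int p" by (simp add: mod_eq_dvd_iff)
      moreover have "u ! i \<in> S" "v ! i \<in> S" using i len S by auto
      ultimately have "e (u ! i) = e (v ! i)" using e by (simp flip: of_nat_mod)
      then show ?thesis using inj \<open>u ! i \<in> S\<close> \<open>v ! i \<in> S\<close> by (auto dest: inj_onD)
    qed
    then show False using len ne by (auto simp: list_eq_iff_nth_eq)
  qed
  then have "card {x \<in> {0..<int p}. int p dvd poly f x} \<le> degree f"
    using p by (intro card_roots_mod_prime) auto
  moreover have "degree f < length u"
    unfolding f_def P_def using u len degree_Poly_less[of "map (\<lambda>a. int (e a)) u"]
      degree_Poly_less[of "map (\<lambda>a. int (e a)) v"]
    by (intro degree_diff_less) auto
  moreover have "int ` {x. x < p \<and> horner_sum e x u mod p = horner_sum e x v mod p} \<subseteq>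
      {x \<in> {0..<int p}. int p dvd poly f x}"
  proof (rule image_subsetI)
    fix x assume "x \<in> {x. x < p \<and> horner_sum e x u mod p = horner_sum e x v mod p}"
    then have x: "x < p" "horner_sum e x u mod p = horner_sum e x v mod p" by simp_all
    then have "int (horner_sum e x u) mod int p = int (horner_sum e x v) mod int p"
      by (simp flip: of_nat_mod)
    then show "int x \<in> {x \<in> {0..<int p}. int p dvd poly f x}"
      using x(1) by (simp add: f_def P_def poly_Poly_horner_sum mod_eq_dvd_iff)
  qed
  then have "card (int ` {x. x < p \<and> horner_sum e x u mod p = horner_sum e x v mod p}) \<le>
      card {x \<in> {0..<int p}. int p dvd poly f x}"
    by (rule card_mono[rotated]) (rule finite_subset[of _ "{0..<int p}"], auto)
  moreover have "card (int ` {x. x < p \<and> horner_sum e x u mod p = horner_sum e x v mod p}) =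
      card {x. x < p \<and> horner_sum e x u mod p = horner_sum e x v mod p}"
    by (intro card_image) (auto simp: inj_on_def)
  ultimately show ?thesis by linarith
qed

section \<open>Reasoning about randomized programs\<close>

text \<open>\<open>steps\<close> extends a run at its end, whereas reasoning about programs peels
  off the first step.\<close>

lemma steps_Suc_first:
  "steps (Suc t) (p, s, ws) = bind_pmf (small_step p s ws) (steps t)"
proof (induction t)
  case 0
  then show ?case by (simp add: bind_return_pmf bind_return_pmf')
next
  case (Suc t)
  have "steps (Suc (Suc t)) (p, s, ws) = bind_pmf (steps (Suc t) (p, s, ws)) (\<lambda>(p, s, ws). small_step p s ws)"
    by simp
  also have "\<dots> = bind_pmf (small_step p s ws) (steps (Suc t))"
    unfolding Suc.IH bind_assoc_pmf by (rule bind_pmf_cong) simp_all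
  finally show ?case .
qed

text \<open>Lets bounds reached at different times in different branches be read off at one common
  time.\<close>

lemma prob_steps_halted_mono:
  assumes "t \<le> t'" "\<And>p s ws. (p, s, ws) \<in> X \<Longrightarrow> p = Skip"
  shows "measure_pmf.prob (steps t c) X \<le> measure_pmf.prob (steps t' c) X"
  using assms(1)
proof (induction rule: dec_induct)
  case (step u)
  have *: "(indicator X x :: ennreal) \<le> emeasure (measure_pmf (case x of (p, s, ws) \<Rightarrow> small_step p s ws)) X" for x
  proof (cases "x \<in> X")
    case True
    obtain p s ws where "x = (p, s, ws)" by (cases x)
    with True assms(2) have "x = (Skip, s, ws)" by blast
    then show ?thesis using True by simp
  qed simp
  then have "emeasure (measure_pmf (steps u c)) X \<le> emeasure (measure_pmf (steps (Suc u) c)) X"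
    unfolding steps.simps emeasure_bind_pmf
    by (subst nn_integral_indicator[symmetric]) (simp, rule nn_integral_mono, rule *)
  then have "measure_pmf.prob (steps u c) X \<le> measure_pmf.prob (steps (Suc u) c) X"
    by (simp add: measure_pmf.emeasure_eq_measure)
  then show ?case using step.IH by linarith
qed simp

text \<open>\<open>I\<close> is an invariant of the memory, \<open>A\<close> the condition under which all runs have to accept,
  \<open>r\<close> a lower bound on the probability of rejection.\<close>

definition outcome :: "((nat \<Rightarrow> nat) \<Rightarrow> bool) \<Rightarrow> bool \<Rightarrow> real \<Rightarrow> 't config \<Rightarrow> bool" where
  "outcome I A r c \<longleftrightarrow>
     (\<forall>t. \<forall>(p, s, ws) \<in> set_pmf (steps t c). I s) \<and>
     (A \<longrightarrow> (\<exists>t. set_pmf (steps t c) \<subseteq> accepting)) \<and>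
     (\<exists>t. r \<le> measure_pmf.prob (steps t c) rejecting)"

lemma outcome_invariant: "outcome I A r c \<Longrightarrow> (p, s, ws) \<in> set_pmf (steps t c) \<Longrightarrow> I s"
  unfolding outcome_def by blast

lemma steps_Skip: "steps t (Skip, s, ws) = return_pmf (Skip, s, ws)"
  by (induction t) (auto simp: bind_return_pmf)

lemma outcome_halted:
  assumes "I s" "A \<Longrightarrow> s 2 \<noteq> 0" "r \<le> of_bool (s 2 = 0)"
  shows "outcome I A r (Skip, s, ws)"
  using assms by (auto simp: outcome_def steps_Skip accepting_def rejecting_def indicator_def)

lemma outcome_det:
  assumes "I s" "small_step p s ws = return_pmf c" "outcome I A r c"
  shows "outcome I A r (p, s, ws)"
proof -
  have S: "steps (Suc t) (p, s, ws) = steps t c" for t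
    unfolding steps_Suc_first assms(2) by (simp add: bind_return_pmf)
  have "I s'" if "(p', s', ws') \<in> set_pmf (steps t (p, s, ws))" for t p' s' ws'
  proof (cases t)
    case 0
    then show ?thesis using that assms(1) by simp
  next
    case (Suc t')
    then show ?thesis using that S[of t'] outcome_invariant[OF assms(3)] by (simp del: steps.simps)
  qed
  then show ?thesis using assms(3) S unfolding outcome_def by (auto simp del: steps.simps(2)) (metis S)+
qed

text \<open>Each branch attains its guarantees at a time of its own; since halted configurations
  persist, a later common time serves both, and the fair coin averages the two rejection
  bounds.\<close>

lemma outcome_flip:
  assumes "I s" "small_step p s ws = map_pmf f (bernoulli_pmf (1 / 2))"
    "outcome I A r0 (f False)" "outcome I A r1 (f True)"
  shows "outcome I A ((r0 + r1) / 2) (p, s, ws)"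
proof -
  have S: "steps (Suc t) (p, s, ws) = bind_pmf (bernoulli_pmf (1 / 2)) (\<lambda>h. steps t (f h))" for t
    unfolding steps_Suc_first assms(2) by (simp add: bind_map_pmf)
  have set_S: "set_pmf (steps (Suc t) (p, s, ws)) = set_pmf (steps t (f False)) \<union> set_pmf (steps t (f True))" for t
    unfolding S by (auto simp: UNIV_bool)
  have "I s'" if "(p', s', ws') \<in> set_pmf (steps t (p, s, ws))" for t p' s' ws'
  proof (cases t)
    case 0
    then show ?thesis using that assms(1) by simp
  next
    case (Suc t')
    then have "(p', s', ws') \<in> set_pmf (steps t' (f False)) \<union> set_pmf (steps t' (f True))"
      using that unfolding Suc set_S by simp
    then show ?thesis using outcome_invariant[OF assms(3)] outcome_invariant[OF assms(4)] by blast
  qed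
  moreover have "\<exists>t. set_pmf (steps t (p, s, ws)) \<subseteq> accepting" if A
  proof -
    obtain t0 t1 where t: "set_pmf (steps t0 (f False)) \<subseteq> accepting" "set_pmf (steps t1 (f True)) \<subseteq> accepting"
      using assms(3,4) \<open>A\<close> unfolding outcome_def by blast
    have mono: "set_pmf (steps (u + d) c) \<subseteq> accepting" if "set_pmf (steps u c) \<subseteq> accepting"
      for u d and c :: "'a config"
      using that
    proof (induction d)
      case (Suc d)
      then show ?case by (fastforce simp: accepting_def)
    qed simp
    have "set_pmf (steps (Suc (t0 + t1)) (p, s, ws)) \<subseteq> accepting"
      unfolding set_S using mono[OF t(1), of t1] mono[OF t(2), of t0] by (simp add: add.commute)
    then show ?thesis by blast
  qed
  moreover have "\<exists>t. (r0 + r1) / 2 \<le> measure_pmf.prob (steps t (p, s, ws)) rejecting"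
  proof -
    obtain t0 t1 where t: "r0 \<le> measure_pmf.prob (steps t0 (f False)) rejecting"
      "r1 \<le> measure_pmf.prob (steps t1 (f True)) rejecting"
      using assms(3,4) unfolding outcome_def by blast
    have halt: "p = Skip" if "(p, s, ws) \<in> rejecting" for p :: "'a prog" and s ws
      using that by (auto simp: rejecting_def)
    define t where "t = max t0 t1"
    have "r0 \<le> measure_pmf.prob (steps t (f False)) rejecting" "r1 \<le> measure_pmf.prob (steps t (f True)) rejecting"
      by (auto simp: t_def intro!: order_trans[OF t(1) prob_steps_halted_mono]
          order_trans[OF t(2) prob_steps_halted_mono] halt)
    moreover have "measure_pmf.prob (steps (Suc t) (p, s, ws)) rejecting =
        (measure_pmf.prob (steps t (f False)) rejecting + measure_pmf.prob (steps t (f True)) rejecting) / 2"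
    proof -
      have "emeasure (steps (Suc t) (p, s, ws)) rejecting =
          ennreal ((measure_pmf.prob (steps t (f False)) rejecting + measure_pmf.prob (steps t (f True)) rejecting) / 2)"
      proof -
        have "ennreal a * ennreal (1 / 2) + ennreal b * ennreal (1 - 1 / 2) = ennreal ((b + a) / 2)"
          if "0 \<le> a" "0 \<le> b" for a b :: real
          using that by (subst (1 2) ennreal_mult[symmetric]) (auto simp flip: ennreal_plus simp: field_simps)
        then show ?thesis
          unfolding S emeasure_bind_pmf
          by (subst nn_integral_bernoulli_pmf) (simp_all add: measure_pmf.emeasure_eq_measure)
      qed
      then show ?thesis
        unfolding measure_pmf.emeasure_eq_measure by (subst (asm) ennreal_inj) simp_all
    qed
    ultimately show ?thesis by (intro exI[of _ "Suc t"]) simp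
  qed
  ultimately show ?thesis unfolding outcome_def by blast
qed

section \<open>Weakest preconditions for coin-free code\<close>

definition det_step :: "((nat \<Rightarrow> nat) \<Rightarrow> bool) \<Rightarrow> 't config \<Rightarrow> 't config \<Rightarrow> bool" where
  "det_step I c c' \<longleftrightarrow> (case c of (p, s, ws) \<Rightarrow> I s \<and> small_step p s ws = return_pmf c')"

text \<open>Total correctness along one deterministic run. The invariant is demanded at every
  configuration passed, because the space bound speaks about all of them and not only about loop
  heads and final states.\<close>

definition wp :: "((nat \<Rightarrow> nat) \<Rightarrow> bool) \<Rightarrow> 't prog \<Rightarrow> ((nat \<Rightarrow> nat) \<Rightarrow> 't list \<Rightarrow> bool) \<Rightarrow>
    (nat \<Rightarrow> nat) \<Rightarrow> 't list \<Rightarrow> bool" where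
  "wp I c Q s ws \<longleftrightarrow> (\<exists>s' ws'. (det_step I)\<^sup>*\<^sup>* (c, s, ws) (Skip, s', ws') \<and> I s' \<and> Q s' ws')"

lemma outcome_det_steps:
  "(det_step I)\<^sup>*\<^sup>* c c' \<Longrightarrow> outcome I A r c' \<Longrightarrow> outcome I A r c"
  by (induction rule: converse_rtranclp_induct) (auto simp: det_step_def intro: outcome_det)

lemma outcome_wp:
  assumes "wp I c Q s ws" "\<And>s' ws'. I s' \<Longrightarrow> Q s' ws' \<Longrightarrow> outcome I A r (Skip, s', ws')"
  shows "outcome I A r (c, s, ws)"
  using assms outcome_det_steps unfolding wp_def by blast

lemma det_steps_Seq_left:
  assumes "(det_step I)\<^sup>*\<^sup>* (c, s, ws) (c', s', ws')"
  shows "(det_step I)\<^sup>*\<^sup>* (Seq c d, s, ws) (Seq c' d, s', ws')"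
  using assms
proof (induction "(c', s', ws')" arbitrary: c' s' ws' rule: rtranclp_induct)
  case (step y)
  obtain c1 s1 ws1 where y: "y = (c1, s1, ws1)" by (cases y)
  have st: "I s1" "small_step c1 s1 ws1 = return_pmf (c', s', ws')"
    using step.hyps(2) by (auto simp: y det_step_def)
  have IH: "(det_step I)\<^sup>*\<^sup>* (Seq c d, s, ws) (Seq c1 d, s1, ws1)" using step.hyps(3) y by simp
  show ?case
  proof (cases "c1 = Skip")
    case True
    then show ?thesis using IH st by (auto simp: return_pmf_inj)
  next
    case False
    then have "det_step I (Seq c1 d, s1, ws1) (Seq c' d, s', ws')"
      using st by (simp add: det_step_def)
    then show ?thesis using IH by (rule rtranclp.rtrancl_into_rtrancl[rotated])
  qed
qed simp

lemma det_steps_Seq: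
  assumes "(det_step I)\<^sup>*\<^sup>* (c, s, ws) (Skip, s', ws')" "I s'"
  shows "(det_step I)\<^sup>*\<^sup>* (Seq c d, s, ws) (d, s', ws')"
proof -
  have "det_step I (Seq Skip d, s', ws') (d, s', ws')"
    using assms(2) by (simp add: det_step_def)
  then show ?thesis using det_steps_Seq_left[OF assms(1), of d] by (rule rtranclp.rtrancl_into_rtrancl[rotated])
qed

lemma wp_step: "I s \<Longrightarrow> small_step c s ws = return_pmf (c', s', ws') \<Longrightarrow> wp I c' Q s' ws' \<Longrightarrow> wp I c Q s ws"
  unfolding wp_def
  by (elim exE conjE, intro exI conjI, rule converse_rtranclp_into_rtranclp) (auto simp: det_step_def)

lemma wp_Skip: "I s \<Longrightarrow> Q s ws \<Longrightarrow> wp I Skip Q s ws"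
  unfolding wp_def by blast

lemma wp_Assign:
  "I s \<Longrightarrow> I (s(x := val a s)) \<Longrightarrow> Q (s(x := val a s)) ws \<Longrightarrow> wp I (Assign x a) Q s ws"
  by (rule wp_step) (auto intro: wp_Skip)

lemma wp_Read:
  "I s \<Longrightarrow> I (s(x := f (if ws = [] then None else Some (hd ws)))) \<Longrightarrow>
    Q (s(x := f (if ws = [] then None else Some (hd ws)))) (tl ws) \<Longrightarrow> wp I (Read x f) Q s ws"
  by (rule wp_step[where c' = Skip and s' = "s(x := f (if ws = [] then None else Some (hd ws)))" and ws' = "tl ws"])
    (auto split: list.split intro: wp_Skip)

lemma wp_Seq: "wp I c (wp I d Q) s ws \<Longrightarrow> wp I (Seq c d) Q s ws"
  unfolding wp_def using det_steps_Seq by (metis (no_types, lifting) rtranclp_trans)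

lemma wp_Cond:
  "I s \<Longrightarrow> (val a s \<noteq> 0 \<Longrightarrow> wp I c Q s ws) \<Longrightarrow> (val a s = 0 \<Longrightarrow> wp I d Q s ws) \<Longrightarrow> wp I (Cond a c d) Q s ws"
  by (cases "val a s = 0") (rule wp_step; auto)+

lemma wp_mono: "wp I c Q s ws \<Longrightarrow> (\<And>s ws. I s \<Longrightarrow> Q s ws \<Longrightarrow> Q' s ws) \<Longrightarrow> wp I c Q' s ws"
  unfolding wp_def by blast

lemma wp_While:
  fixes m :: "(nat \<Rightarrow> nat) \<Rightarrow> nat"
  assumes "Inv s ws" "I s"
    "\<And>s ws. Inv s ws \<Longrightarrow> I s \<Longrightarrow> val a s \<noteq> 0 \<Longrightarrow> wp I c (\<lambda>s' ws'. Inv s' ws' \<and> m s' < m s) s ws"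
    "\<And>s ws. Inv s ws \<Longrightarrow> I s \<Longrightarrow> val a s = 0 \<Longrightarrow> Q s ws"
  shows "wp I (While a c) Q s ws"
  using assms(1,2)
proof (induction "m s" arbitrary: s ws rule: less_induct)
  case less
  show ?case
  proof (cases "val a s = 0")
    case True
    then show ?thesis using less.prems assms(4) by (intro wp_step[of I s]) (auto intro: wp_Skip)
  next
    case False
    then have "wp I c (\<lambda>s' ws'. Inv s' ws' \<and> m s' < m s) s ws" using assms(3) less.prems by blast
    then have "wp I c (wp I (While a c) Q) s ws"
      using less.hyps by (rule wp_mono) auto
    then have "wp I (Seq c (While a c)) Q s ws" by (rule wp_Seq)
    then show ?thesis using False less.prems by (intro wp_step[of I s]) auto
  qed
qed

section \<open>The recognizer\<close>

lemma outcome_wp_Seq: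
  assumes "wp I c Q s ws" "\<And>s' ws'. I s' \<Longrightarrow> Q s' ws' \<Longrightarrow> outcome I A r (d, s', ws')"
  shows "outcome I A r (Seq c d, s, ws)"
proof -
  obtain s' ws' where s': "(det_step I)\<^sup>*\<^sup>* (c, s, ws) (Skip, s', ws')" "I s'" "Q s' ws'"
    using assms(1) unfolding wp_def by blast
  show ?thesis by (rule outcome_det_steps[OF det_steps_Seq[OF s'(1,2)] assms(2)[OF s'(2,3)]])
qed

text \<open>After a coin flip the rest of the loop body stands in front of the loop, and both stand
  in front of the continuation; this rule finishes the body in that nested position.\<close>

lemma outcome_wp_Seq_Seq:
  assumes "wp I c Q s ws" "\<And>s' ws'. I s' \<Longrightarrow> Q s' ws' \<Longrightarrow> outcome I A r (Seq d f, s', ws')"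
  shows "outcome I A r (Seq (Seq c d) f, s, ws)"
proof -
  obtain s' ws' where s': "(det_step I)\<^sup>*\<^sup>* (c, s, ws) (Skip, s', ws')" "I s'" "Q s' ws'"
    using assms(1) unfolding wp_def by blast
  show ?thesis
    by (rule outcome_det_steps[OF det_steps_Seq_left[OF det_steps_Seq[OF s'(1,2)]] assms(2)[OF s'(2,3)]])
qed

text \<open>One common bound for the variables \<open>0\<close> to \<open>21\<close>, the only ones
  that the recognizer uses; the space is then at most 22 times the bit length of M.\<close>

definition bounded_mem :: "nat \<Rightarrow> (nat \<Rightarrow> nat) \<Rightarrow> bool" where
  "bounded_mem M s \<longleftrightarrow> (\<forall>v \<ge> 22. s v = 0) \<and> (\<forall>v. s v \<le> M)"

lemma bounded_mem_upd [simp]: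
  "bounded_mem M s \<Longrightarrow> v < 22 \<Longrightarrow> bounded_mem M (s(v := a)) \<longleftrightarrow> a \<le> M"
proof
  assume "bounded_mem M (s(v := a))"
  then have "(s(v := a)) v \<le> M" unfolding bounded_mem_def by blast
  then show "a \<le> M" by simp
qed (simp add: bounded_mem_def)

lemma bounded_mem_outside: "bounded_mem M s \<Longrightarrow> 22 \<le> v \<Longrightarrow> s v = 0"
  by (simp add: bounded_mem_def)

lemma bounded_mem_le: "bounded_mem M s \<Longrightarrow> s v \<le> M"
  by (simp add: bounded_mem_def)

lemma memory_bits_bounded_mem:
  assumes "bounded_mem M s"
  shows "memory_bits s \<le> 22 * floorlog 2 M"
proof -
  have "(\<Sum>x | s x \<noteq> 0. floorlog 2 (s x)) \<le> (\<Sum>x<22. floorlog 2 (s x))"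
  proof (rule sum_mono2)
    show "{x. s x \<noteq> 0} \<subseteq> {..<22}"
    proof
      fix v assume "v \<in> {x. s x \<noteq> 0}"
      then show "v \<in> {..<22}" using bounded_mem_outside[OF assms, of v] by (cases "22 \<le> v") simp_all
    qed
  qed auto
  also have "\<dots> \<le> (\<Sum>x<(22::nat). floorlog 2 M)"
    by (intro sum_mono floorlog_mono bounded_mem_le[OF assms])
  finally show ?thesis by (simp add: memory_bits_def)
qed

primrec block :: "'t prog list \<Rightarrow> 't prog" where
  "block [] = Skip"
| "block (c # cs) = Seq c (block cs)"

definition same_mem :: "nat set \<Rightarrow> (nat \<Rightarrow> nat) \<Rightarrow> (nat \<Rightarrow> nat) \<Rightarrow> bool" where
  "same_mem X s s' \<longleftrightarrow> (\<forall>v. v \<notin> X \<longrightarrow> s' v = s v)"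

lemma same_mem_trans: "same_mem X s s' \<Longrightarrow> same_mem Y s' s'' \<Longrightarrow> X \<union> Y \<subseteq> Z \<Longrightarrow> same_mem Z s s''"
  unfolding same_mem_def by (metis UnCI subsetD)

lemma div_le_trans: "a \<le> M \<Longrightarrow> a div c \<le> (M::nat)"
  using div_le_dividend[of a c] by linarith

text \<open>Subtraction truncates at 0, so this is the absolute difference; as a condition it tests
  whether the two values are different.\<close>

abbreviation Differ :: "expr \<Rightarrow> expr \<Rightarrow> expr" where
  "Differ a c \<equiv> Plus (Minus a c) (Minus c a)"

section \<open>Encoding of the parse and the program text\<close>

primrec blk :: "('n, 't) symbol list \<Rightarrow> 't list" where
  "blk [] = []"
| "blk (s # \<gamma>) = (case s of Tm a \<Rightarrow> a # blk \<gamma> | Nt A \<Rightarrow> [])"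

lemma length_blk: "length (blk \<gamma>) \<le> num_terminals \<gamma>"
  by (induction \<gamma>) (auto split: symbol.split)

lemma blk_split: "\<exists>\<delta>. \<gamma> = map Tm (blk \<gamma>) @ \<delta> \<and> (\<delta> = [] \<or> (\<exists>A \<delta>'. \<delta> = Nt A # \<delta>'))"
proof (induction \<gamma>)
  case (Cons s \<gamma>)
  then show ?case by (cases s) auto
qed auto

lemma blk_map_Tm [simp]: "blk (map Tm z @ \<gamma>) = z @ blk \<gamma>"
  by (induction z) auto

text \<open>Codes start at 1, so that 0 can mean the end of the input among letters and the empty
  stack among stack values. The list \<open>ents\<close> tabulates all matching triples of
  nonterminal, lookahead and right-hand side.\<close>

locale ll_parser =
  fixes G :: "('n, 't) cfg" and k :: nat and e :: "'t \<Rightarrow> nat" and nc :: "'n \<Rightarrow> nat"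
    and ents :: "('n \<times> 't list \<times> ('n, 't) symbol list) list" and m :: nat
  assumes wf: "wf_cfg G" and LL: "LL k G" and k: "k > 0"
    and e_inj: "inj_on e (alphabet G)" and e_range: "\<And>a. a \<in> alphabet G \<Longrightarrow> 0 < e a \<and> e a \<le> card (alphabet G)"
    and nc_inj: "inj_on nc (nonterminals G)"
    and nc_range: "\<And>A. A \<in> nonterminals G \<Longrightarrow> 0 < nc A \<and> nc A \<le> card (nonterminals G)"
    and ents: "set ents = {(A, u, \<alpha>). (A, \<alpha>) \<in> productions G \<and> u \<in> select G k (A, \<alpha>)}"
    and m: "\<And>A \<alpha>. (A, \<alpha>) \<in> productions G \<Longrightarrow> length \<alpha> \<le> m"
begin

definition W :: nat where "W = Suc (card (alphabet G))"

text \<open>Added to a modulus that is at least n, this gives a base above every stack digit (block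
  lengths up to n + \<open>m\<close>, nonterminal codes, fingerprints) and above every window value,
  which is below \<open>W ^ k\<close>.\<close>

definition cst :: nat where "cst = m + card (nonterminals G) + W ^ k + 2"

text \<open>The lookahead is coded in base \<open>W\<close>; the digit \<open>0\<close> stands for the end of the input.\<close>

definition code :: "'t list \<Rightarrow> nat" where "code u = horner_sum e W u"

definition table :: "'t option \<Rightarrow> nat" where
  "table r = (case r of None \<Rightarrow> 0 | Some a \<Rightarrow> e a)"

abbreviation (input) "vn \<equiv> Var 0"
abbreviation (input) "vb \<equiv> Var 1"
abbreviation (input) "tmp \<equiv> Var 3"
abbreviation (input) "choices \<equiv> Var 4"
abbreviation (input) "point \<equiv> Var 5"
abbreviation (input) "modulus \<equiv> Var 6"
abbreviation (input) "divisor \<equiv> Var 7"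
abbreviation (input) "base \<equiv> Var 8"
abbreviation (input) "fuel \<equiv> Var 9"
abbreviation (input) "counter \<equiv> Var 10"
abbreviation (input) "top_length \<equiv> Var 11"
abbreviation (input) "top_hash \<equiv> Var 12"
abbreviation (input) "stack \<equiv> Var 13"
abbreviation (input) "pow \<equiv> Var 14"
abbreviation (input) "predicted \<equiv> Var 15"
abbreviation (input) "actual \<equiv> Var 16"
abbreviation (input) "window \<equiv> Var 17"
abbreviation (input) "generated \<equiv> Var 18"
abbreviation (input) "pending \<equiv> Var 19"
abbreviation (input) "nonterm \<equiv> Var 20"
abbreviation (input) "ok \<equiv> Var 21"

text \<open>Trial division: the search ends when the divisor has climbed to the candidate itself.
  Starting at \<open>choices\<close> plus \<open>W\<close> keeps all drawable points and all letter
  codes below the modulus.\<close>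

definition search_prime :: "'t prog" where
  "search_prime = block [
     Assign 6 (Plus choices (Const W)),
     Assign 7 (Const 2),
     While (Minus modulus divisor)
       (Cond (Rem modulus divisor)
          (Assign 7 (Plus divisor (Const 1)))
          (Seq (Assign 6 (Plus modulus (Const 1))) (Assign 7 (Const 2))))]"

primrec fill :: "nat \<Rightarrow> 't prog" where
  "fill 0 = Skip"
| "fill (Suc j) = Seq (fill j) (Seq (Read 3 table) (Assign 17 (Plus window (Times tmp (Const (W ^ j))))))"

text \<open>The loop leaves base^(2 (b + 1)) in \<open>fuel\<close>: base^2 to begin with and
  another base^2 for each unit of b.\<close>

definition init_parse :: "'t prog" where
  "init_parse = block [
     Assign 8 (Plus modulus (Const cst)),
     Assign 9 (Times base base),
     Assign 10 vb,
     While counter (Seq (Assign 9 (Times fuel (Times base base))) (Assign 10 (Minus counter (Const 1)))),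
     Assign 13 (Const (nc (start G))),
     Assign 14 (Const 1),
     Assign 19 (Const 1),
     Assign 21 (Const 1),
     fill k]"

text \<open>The terminal block on top of the stack is held in \<open>top_length\<close> and \<open>top_hash\<close>; below it, each
  entry of \<open>stack\<close> takes three digits in base \<open>base\<close>: a nonterminal and the length and the
  fingerprint of the terminal block following it.\<close>

primrec push :: "('n, 't) symbol \<Rightarrow> 't prog" where
  "push (Tm a) = block [
     Assign 11 (Plus top_length (Const 1)),
     Assign 12 (Rem (Plus (Const (e a)) (Times point top_hash)) modulus),
     Assign 18 (Plus generated (Const 1))]"
| "push (Nt A) = block [
     Assign 13 (Plus (Times (Plus (Times (Plus (Times stack base) top_hash) base) top_length) base)
       (Const (nc A))),
     Assign 11 (Const 0),
     Assign 12 (Const 0),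
     Assign 19 (Plus pending (Const 1))]"

primrec pushes :: "('n, 't) symbol list \<Rightarrow> 't prog" where
  "pushes [] = Skip"
| "pushes (s # \<alpha>) = Seq (pushes \<alpha>) (push s)"

primrec lookup :: "('n \<times> 't list \<times> ('n, 't) symbol list) list \<Rightarrow> 't prog" where
  "lookup [] = Assign 21 (Const 0)"
| "lookup (r # rs) = (case r of (A, u, \<alpha>) \<Rightarrow>
     Cond (Plus (Differ nonterm (Const (nc A))) (Differ window (Const (code u)))) (lookup rs) (pushes \<alpha>))"

text \<open>The lowest digit of the window is the current letter, and the letter entering at the top
  place lies k positions further on. The current letter is added to \<open>actual\<close> with
  weight \<open>pow\<close>, so that the fingerprint grows by appending.\<close>

definition consume_letter :: "'t prog" where
  "consume_letter = block [
     Assign 16 (Rem (Plus actual (Times pow (Rem window (Const W)))) modulus),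
     Assign 14 (Rem (Times pow point) modulus),
     Read 3 table,
     Assign 17 (Plus (Quot window (Const W)) (Times tmp (Const (W ^ (k - 1))))),
     Assign 11 (Minus top_length (Const 1))]"

text \<open>The leading block is already accounted for in \<open>predicted\<close>, so
  \<open>top_length\<close> and \<open>top_hash\<close> are free to receive the block behind the
  popped nonterminal.\<close>

definition pop :: "'t prog" where
  "pop = block [
     Assign 9 (Minus fuel (Const 1)),
     Assign 20 (Rem stack base),
     Assign 13 (Quot stack base),
     Assign 11 (Rem stack base),
     Assign 13 (Quot stack base),
     Assign 12 (Rem stack base),
     Assign 13 (Quot stack base),
     Assign 19 (Minus pending (Const 1))]"

text \<open>The new leading block enters \<open>predicted\<close> before the letters are consumed:
  its weight is the power of the point at the old position, and consuming advances
  \<open>pow\<close>.\<close>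

definition parse_step :: "'t prog" where
  "parse_step = Seq pop (Seq (lookup ents)
     (Cond (Plus (Minus (Const 1) ok) (Plus (Minus generated vn) (Minus pending vb)))
        (Assign 21 (Const 0))
        (Seq (Assign 15 (Rem (Plus predicted (Times pow top_hash)) modulus))
           (While top_length consume_letter))))"

text \<open>An empty stack together with \<open>generated\<close> equal to n means that as many
  letters were consumed as the input has, so the two fingerprints compared at the end belong to
  complete words.\<close>

definition parse :: "'t prog" where
  "parse = Seq search_prime (Seq init_parse
     (Seq (While (Times fuel (Times stack ok)) parse_step)
        (Cond (Plus (Minus (Const 1) ok) (Plus stack (Plus (Differ generated vn) (Differ predicted actual))))
           Skip (Assign 2 (Const 1)))))"

text \<open>Doubling \<open>choices\<close> with every bit keeps the point exactly uniform below
  \<open>choices\<close>; the number of flips depends on n only.\<close>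

definition draw_point :: "'t prog" where
  "draw_point = While (Minus (Times vn vn) choices)
     (Seq (Flip 3) (Seq (Assign 5 (Plus (Times (Const 2) point) tmp)) (Assign 4 (Times (Const 2) choices))))"

text \<open>For fewer than two letters accepting is always admissible: 1 - 1/n is 0 for n = 1, and
  no rejection is demanded for n = 0.\<close>

definition recognizer :: "'t prog" where
  "recognizer = Cond (Quot vn (Const 2))
     (Seq (Assign 4 (Const 1)) (Seq draw_point parse))
     (Assign 2 (Const 1))"

lemma W_pos: "W > 0" by (simp add: W_def)

lemma e_less_W: "a \<in> alphabet G \<Longrightarrow> e a < W"
  using e_range by (fastforce simp: W_def)

lemma code_less: "u \<in> lists (alphabet G) \<Longrightarrow> code u < W ^ length u"
proof (induction u)
  case (Cons a u)
  then have "code u + 1 \<le> W ^ length u" "e a < W" using e_less_W by auto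
  then have "W * (code u + 1) \<le> W * W ^ length u" by (intro mult_left_mono) auto
  then show ?case using \<open>e a < W\<close> by (simp add: code_def)
qed (simp add: code_def)

text \<open>Letters have nonzero digits, so even words of different lengths get different codes.
  This matters near the end of the input, where lookaheads are shorter than k.\<close>

lemma code_inj: "u \<in> lists (alphabet G) \<Longrightarrow> v \<in> lists (alphabet G) \<Longrightarrow> code u = code v \<Longrightarrow> u = v"
proof (induction u arbitrary: v)
  case Nil
  then show ?case by (cases v) (auto simp: code_def W_def dest!: e_range)
next
  case (Cons a u)
  obtain b v' where v: "v = b # v'"
    using Cons.prems by (cases v) (auto simp: code_def W_def dest!: e_range)
  have lt: "e a < W" "e b < W" using Cons.prems v e_less_W by auto
  have eq: "e a + W * code u = e b + W * code v'" using Cons.prems(3) v by (simp add: code_def)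
  from arg_cong[OF eq, of "\<lambda>z. z mod W"] have "e a = e b" using lt by simp
  moreover from arg_cong[OF eq, of "\<lambda>z. z div W"] have "code u = code v'"
    using lt W_pos by simp
  ultimately show ?case using Cons v e_inj by (auto dest: inj_onD)
qed

text \<open>Division by W removes the current letter, and the next unread one enters at place k - 1.
  At the end of the input the entering digit is 0, which agrees with the code of a shorter
  lookahead.\<close>

lemma code_shift:
  assumes "set (a # r) \<subseteq> alphabet G"
  shows "code (take k (a # r)) mod W = e a"
    and "code (take k (a # r)) div W + table (if drop k (a # r) = [] then None else Some (hd (drop k (a # r)))) * W ^ (k - 1)
      = code (take k r)"
proof -
  obtain k' where k': "k = Suc k'" using k by (cases k) auto
  have e: "e a < W" using assms e_less_W by auto
  have c: "code (take k (a # r)) = e a + W * code (take k' r)" by (simp add: k' code_def)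
  then show "code (take k (a # r)) mod W = e a" using e by simp
  have "code (take k r) = code (take k' r) + table (if drop k' r = [] then None else Some (hd (drop k' r))) * W ^ k'"
  proof (cases "k' < length r")
    case True
    then show ?thesis
      by (simp add: k' take_Suc_conv_app_nth code_def table_def hd_drop_conv_nth horner_sum_append)
  next
    case False
    then show ?thesis by (simp add: k' table_def)
  qed
  then show "code (take k (a # r)) div W + table (if drop k (a # r) = [] then None else Some (hd (drop k (a # r)))) * W ^ (k - 1)
      = code (take k r)"
    using c e W_pos by (simp add: k')
qed

lemma select_subset: "u \<in> select G k p \<Longrightarrow> u \<in> lists (alphabet G)"
  unfolding select_def by (auto dest: in_set_takeD)

end

section \<open>Correctness of the parse for one fixed point and modulus\<close>

locale ll_run = ll_parser G k e nc ents m
  for G :: "('n, 't) cfg" and k e nc ents m +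
  fixes w :: "'t list" and b x p :: nat
  assumes w: "w \<in> lists (alphabet G)" and b: "b > 0"
    and xp: "x < p" and np: "length w \<le> p" and Wp: "W \<le> p" and p1: "1 < p"
begin

definition B :: nat where "B = p + cst"

text \<open>Three digits for each of up to b + \<open>m\<close> nonterminals, the count reached
  before the limit b is checked; the extra 4 leaves room for the initial fuel
  \<open>B ^ (2 * (b + 1))\<close>.\<close>

definition M :: nat where "M = B ^ (3 * (b + m) + 4)"

abbreviation hash :: "'t list \<Rightarrow> nat" where "hash z \<equiv> horner_sum e x z mod p"

abbreviation ok_mem :: "(nat \<Rightarrow> nat) \<Rightarrow> bool" where "ok_mem \<equiv> bounded_mem M"

lemma B_ge: "p \<le> B" "length w + m < B" "card (nonterminals G) < B" "W ^ k < B" "2 \<le> B" "x < B"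
  using xp np by (auto simp: B_def cst_def)

lemma B_power_le_M: "i \<le> 3 * (b + m) + 4 \<Longrightarrow> B ^ i \<le> M"
  unfolding M_def using B_ge(5) by (intro power_increasing) auto

lemma B_le_M: "B \<le> M" using B_power_le_M[of 1] by simp

lemma bm_le_M: "b + m < M"
proof -
  have "b + m < 2 ^ (b + m)" by (rule less_exp)
  also have "\<dots> \<le> B ^ (b + m)" using B_ge(5) by (intro power_mono) auto
  also have "\<dots> \<le> M" by (rule B_power_le_M) simp
  finally show ?thesis .
qed

lemma mod_p_le_M: "a mod p \<le> M"
proof -
  have "a mod p < p" using p1 by simp
  then show ?thesis using B_ge(1) B_le_M by linarith
qed

lemma hash_less: "hash z < B"
proof -
  have "hash z < p" using p1 by simp
  then show ?thesis using B_ge(1) by linarith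
qed

primrec stk :: "('n, 't) symbol list \<Rightarrow> nat" where
  "stk [] = 0"
| "stk (s # \<gamma>) = (case s of Tm a \<Rightarrow> stk \<gamma>
     | Nt A \<Rightarrow> ((stk \<gamma> * B + hash (blk \<gamma>)) * B + length (blk \<gamma>)) * B + nc A)"

lemma stk_map_Tm [simp]: "stk (map Tm z @ \<gamma>) = stk \<gamma>"
  by (induction z) auto

lemma digit_bound: "S < B ^ i \<Longrightarrow> d < B \<Longrightarrow> S * B + d < B ^ Suc i"
proof -
  assume "S < B ^ i" "d < B"
  then have "S * B + d < (S + 1) * B" by simp
  also have "\<dots> \<le> B ^ i * B" using \<open>S < B ^ i\<close> by (intro mult_right_mono) auto
  finally show ?thesis by (simp add: mult.commute)
qed

lemma stk_bound:
  "num_terminals \<gamma> \<le> length w + m \<Longrightarrow> set \<gamma> \<subseteq> Nt ` nonterminals G \<union> Tm ` alphabet G \<Longrightarrow>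
    stk \<gamma> < B ^ (3 * num_nonterminals \<gamma>)"
proof (induction \<gamma>)
  case (Cons s \<gamma>)
  show ?case
  proof (cases s)
    case (Nt A)
    then have "A \<in> nonterminals G" using Cons.prems by auto
    then have "nc A < B" using nc_range[of A] B_ge(3) by linarith
    moreover have "length (blk \<gamma>) < B"
      using length_blk[of \<gamma>] Cons.prems Nt B_ge(2) by simp
    moreover have "stk \<gamma> < B ^ (3 * num_nonterminals \<gamma>)" using Cons Nt by simp
    ultimately have "((stk \<gamma> * B + hash (blk \<gamma>)) * B + length (blk \<gamma>)) * B + nc A
        < B ^ Suc (Suc (Suc (3 * num_nonterminals \<gamma>)))"
      by (intro digit_bound hash_less)
    moreover have eq: "3 * num_nonterminals (s # \<gamma>) = Suc (Suc (Suc (3 * num_nonterminals \<gamma>)))"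
      using Nt by simp
    ultimately show ?thesis unfolding eq by (simp only: Nt stk.simps symbol.case)
  next
    case (Tm a)
    then show ?thesis using Cons by simp
  qed
qed simp

lemma stk_le_M:
  assumes "num_terminals \<gamma> \<le> length w + m" "set \<gamma> \<subseteq> Nt ` nonterminals G \<union> Tm ` alphabet G"
    "num_nonterminals \<gamma> \<le> b + m"
  shows "stk \<gamma> \<le> M"
proof -
  have "B ^ (3 * num_nonterminals \<gamma>) \<le> M" using assms(3) by (intro B_power_le_M) simp
  then show ?thesis using stk_bound[OF assms(1,2)] by linarith
qed

text \<open>The relation in force while a right-hand side is pushed: g counts the terminals in front
  of \<gamma> that left the stack earlier, and the leading block of \<gamma> is still held in
  \<open>top_length\<close> and \<open>top_hash\<close>.\<close>

definition repr :: "('n, 't) symbol list \<Rightarrow> nat \<Rightarrow> (nat \<Rightarrow> nat) \<Rightarrow> bool" where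
  "repr \<gamma> g s \<longleftrightarrow> s 5 = x \<and> s 6 = p \<and> s 8 = B \<and> s 11 = length (blk \<gamma>) \<and> s 12 = hash (blk \<gamma>) \<and>
     s 13 = stk \<gamma> \<and> s 18 = g + num_terminals \<gamma> \<and> s 19 = num_nonterminals \<gamma>"

lemma wp_push:
  assumes "ok_mem s" "repr \<gamma> g s" "g + num_terminals (a # \<gamma>) \<le> length w + m"
    "num_nonterminals (a # \<gamma>) \<le> b + m" "set (a # \<gamma>) \<subseteq> Nt ` nonterminals G \<union> Tm ` alphabet G"
  shows "wp ok_mem (push a) (\<lambda>s' ws'. ws' = ws \<and> repr (a # \<gamma>) g s' \<and> same_mem {11, 12, 13, 18, 19} s s') s ws"
proof (cases a)
  case (Tm c)
  have "Suc (length (blk \<gamma>)) \<le> M" "Suc (g + num_terminals \<gamma>) \<le> M"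
    using assms(3) Tm B_ge(2) B_le_M length_blk[of \<gamma>] by simp_all
  moreover have "(e c + x * (horner_sum e x (blk \<gamma>) mod p)) mod p = (e c + x * horner_sum e x (blk \<gamma>)) mod p"
    by (metis mod_add_right_eq mod_mult_right_eq)
  ultimately show ?thesis using assms(1,2) Tm
    unfolding repr_def by (simp only: push.simps block.simps) (intro wp_Seq wp_Assign wp_Skip; simp add: mod_p_le_M same_mem_def)
next
  case (Nt A)
  have "stk (a # \<gamma>) \<le> M" using assms by (intro stk_le_M) auto
  moreover have "Suc (num_nonterminals \<gamma>) \<le> M" using assms(4) Nt bm_le_M by simp
  ultimately show ?thesis using assms(1,2) Nt
    unfolding repr_def by (simp only: push.simps block.simps) (intro wp_Seq wp_Assign wp_Skip; simp add: same_mem_def)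
qed

lemma wp_pushes:
  assumes "ok_mem s" "repr \<gamma> g s" "g + num_terminals (\<alpha> @ \<gamma>) \<le> length w + m"
    "num_nonterminals (\<alpha> @ \<gamma>) \<le> b + m" "set (\<alpha> @ \<gamma>) \<subseteq> Nt ` nonterminals G \<union> Tm ` alphabet G"
  shows "wp ok_mem (pushes \<alpha>) (\<lambda>s' ws'. ws' = ws \<and> repr (\<alpha> @ \<gamma>) g s' \<and> same_mem {11, 12, 13, 18, 19} s s') s ws"
  using assms(3-5)
proof (induction \<alpha>)
  case Nil
  then show ?case using assms(1,2) by (auto intro!: wp_Skip simp: same_mem_def)
next
  case (Cons a \<alpha>)
  have "g + num_terminals (\<alpha> @ \<gamma>) \<le> length w + m" "num_nonterminals (\<alpha> @ \<gamma>) \<le> b + m"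
    "set (\<alpha> @ \<gamma>) \<subseteq> Nt ` nonterminals G \<union> Tm ` alphabet G"
    using Cons.prems by (cases a; simp)+
  from Cons.IH[OF this] show ?case unfolding pushes.simps
  proof (intro wp_Seq, elim wp_mono)
    fix s' ws' assume s': "ok_mem s'" "ws' = ws \<and> repr (\<alpha> @ \<gamma>) g s' \<and> same_mem {11, 12, 13, 18, 19} s s'"
    then have "wp ok_mem (push a) (\<lambda>s'' ws''. ws'' = ws' \<and> repr (a # \<alpha> @ \<gamma>) g s'' \<and> same_mem {11, 12, 13, 18, 19} s' s'') s' ws'"
      using Cons.prems by (intro wp_push) auto
    then show "wp ok_mem (push a) (\<lambda>s'' ws''. ws'' = ws \<and> repr ((a # \<alpha>) @ \<gamma>) g s'' \<and> same_mem {11, 12, 13, 18, 19} s s'') s' ws'"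
      by (rule wp_mono) (use s' in \<open>auto intro: same_mem_trans\<close>)
  qed
qed

lemma wp_lookup:
  assumes "ok_mem s" "s 20 = nc A" "s 17 = code u" "A \<in> nonterminals G" "u \<in> lists (alphabet G)"
    "set rs \<subseteq> set ents"
    "\<And>\<alpha>. (A, u, \<alpha>) \<in> set rs \<Longrightarrow> wp ok_mem (pushes \<alpha>) Q s ws"
    "(\<And>\<alpha>. (A, u, \<alpha>) \<notin> set rs) \<Longrightarrow> Q (s(21 := 0)) ws"
  shows "wp ok_mem (lookup rs) Q s ws"
  using assms(6-)
proof (induction rs)
  case Nil
  have "Q (s(21 := 0)) ws" by (rule Nil.prems(3)) simp
  moreover have "ok_mem (s(21 := 0))" using assms(1) by simp
  ultimately show ?case unfolding lookup.simps by (intro wp_Assign assms(1)) (simp_all only: val.simps)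
next
  case (Cons r rs)
  obtain A' u' \<alpha>' where r: "r = (A', u', \<alpha>')" by (cases r)
  then have "(A', u', \<alpha>') \<in> set ents" using Cons.prems by auto
  then have r': "A' \<in> nonterminals G" "u' \<in> lists (alphabet G)"
  proof -
    have "(A', \<alpha>') \<in> productions G" "u' \<in> select G k (A', \<alpha>')"
      using \<open>(A', u', \<alpha>') \<in> set ents\<close> unfolding ents by blast+
    then show "A' \<in> nonterminals G" "u' \<in> lists (alphabet G)"
      using wf select_subset unfolding wf_cfg_def by blast+
  qed
  show ?case unfolding lookup.simps r prod.case
  proof (rule wp_Cond)
    show "ok_mem s" by (rule assms(1))
  next
    assume "val (Plus (Differ nonterm (Const (nc A'))) (Differ window (Const (code u')))) s \<noteq> 0"
    then have "(A', u') \<noteq> (A, u)" using assms(2,3) by auto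
    then show "wp ok_mem (lookup rs) Q s ws" using Cons r by auto
  next
    assume "val (Plus (Differ nonterm (Const (nc A'))) (Differ window (Const (code u')))) s = 0"
    then have "nc A' = nc A" "code u' = code u" using assms(2,3) by auto
    then have "A' = A" "u' = u" using nc_inj code_inj r' assms(4,5) by (auto dest: inj_onD)
    then show "wp ok_mem (pushes \<alpha>') Q s ws" using Cons.prems r by auto
  qed
qed

text \<open>The input head is k letters ahead of the parse position j, because the letters from j to
  j + k - 1 sit in the window.\<close>

definition reading_at :: "nat \<Rightarrow> (nat \<Rightarrow> nat) \<Rightarrow> 't list \<Rightarrow> bool" where
  "reading_at j s ws \<longleftrightarrow> s 14 = x ^ j mod p \<and> s 16 = hash (take j w) \<and>
     s 17 = code (take k (drop j w)) \<and> ws = drop (j + k) w"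

lemma window_le_M:
  assumes "u \<in> lists (alphabet G)" "length u \<le> k"
  shows "code u \<le> M"
proof -
  have "W ^ length u \<le> W ^ k" using assms(2) W_pos by (intro power_increasing) auto
  then show ?thesis using code_less[OF assms(1)] B_ge(4) B_le_M by linarith
qed

lemma table_le_M: "ws = [] \<or> hd ws \<in> alphabet G \<Longrightarrow> table (if ws = [] then None else Some (hd ws)) \<le> M"
  using e_less_W[of "hd ws"] Wp B_ge(1) B_le_M by (auto simp: table_def)

lemma wp_consume_letter:
  assumes "ok_mem s" "reading_at j s ws" "j < length w" "s 11 = Suc l" "s 5 = x" "s 6 = p"
  shows "wp ok_mem consume_letter (\<lambda>s' ws'. reading_at (Suc j) s' ws' \<and> s' 11 = l \<and>
    same_mem {3, 11, 14, 16, 17} s s') s ws"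
proof -
  define a r where "a = w ! j" and "r = drop (Suc j) w"
  have jr: "drop j w = a # r" using assms(3) by (simp add: a_def r_def Cons_nth_drop_Suc)
  have ar: "set (a # r) \<subseteq> alphabet G" using w set_drop_subset[of j w] unfolding jr by auto
  have "drop (j + k) w = drop k (drop j w)" by (simp add: add.commute)
  then have ws: "ws = drop k (a # r)"
    using assms(2) unfolding jr by (simp add: reading_at_def)
  have tl: "tl ws = drop (Suc j + k) w"
    using assms(2) by (simp add: reading_at_def drop_Suc tl_drop)
  have hd: "ws = [] \<or> hd ws \<in> alphabet G"
    using ar set_drop_subset[of k "a # r"] unfolding ws[symmetric] by (cases ws) auto
  have take: "take (Suc j) w = take j w @ [a]" using assms(3) by (simp add: a_def take_Suc_conv_app_nth)
  \<comment> \<open>The letter at position j has weight x^j, so appending a letter leaves the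
    earlier weights alone.\<close>
  have hash: "(hash (take j w) + (x ^ j mod p) * e a) mod p = hash (take (Suc j) w)"
  proof -
    have "(hash (take j w) + (x ^ j mod p) * e a) mod p = (horner_sum e x (take j w) + x ^ j * e a) mod p"
      by (intro mod_add_cong mod_mult_left_eq mod_mod_trivial)
    then show ?thesis using assms(3) by (simp only: take horner_sum_append) simp
  qed
  have pow: "(x ^ j mod p) * x mod p = x ^ Suc j mod p"
    by (simp add: mod_simps mult.commute)
  have win: "code (take k (a # r)) div W + table (if ws = [] then None else Some (hd ws)) * W ^ (k - 1)
      = code (take k (drop (Suc j) w))"
    using code_shift(2)[OF ar] by (simp only: ws r_def)
  have "code (take k (drop (Suc j) w)) \<le> M"
    using w by (intro window_le_M) (auto dest: in_set_takeD in_set_dropD)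
  moreover have "l \<le> M" using bounded_mem_le[OF assms(1), of 11] assms(4) by simp
  moreover have "table (if ws = [] then None else Some (hd ws)) \<le> M" by (rule table_le_M[OF hd])
  moreover note code_shift(1)[OF ar] hash pow win tl
  moreover have "s 14 = x ^ j mod p" "s 16 = hash (take j w)" "s 17 = code (take k (a # r))"
    using assms(2) by (auto simp: reading_at_def jr)
  ultimately show ?thesis using assms(1,4-6) unfolding consume_letter_def block.simps
    by (intro wp_Seq wp_Assign wp_Read wp_Skip;
        simp add: mod_p_le_M same_mem_def reading_at_def del: horner_sum_append power_Suc)
qed

abbreviation predicts :: "('n, 't) symbol list \<Rightarrow> ('n, 't) symbol list \<Rightarrow> bool" where
  "predicts \<equiv> predict G k b w"

lemma wp_consume:
  assumes "ok_mem s" "reading_at j s ws" "j + l \<le> length w" "s 11 = l" "s 5 = x" "s 6 = p"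
  shows "wp ok_mem (While top_length consume_letter)
    (\<lambda>s' ws'. reading_at (j + l) s' ws' \<and> same_mem {3, 11, 14, 16, 17} s s') s ws"
proof (rule wp_While[where Inv = "\<lambda>s' ws'. \<exists>i. i + s' 11 = l \<and> reading_at (j + i) s' ws' \<and>
      same_mem {3, 11, 14, 16, 17} s s'" and m = "\<lambda>s. s 11"])
  show "\<exists>i. i + s 11 = l \<and> reading_at (j + i) s ws \<and> same_mem {3, 11, 14, 16, 17} s s"
    using assms by (auto simp: same_mem_def)
  show "ok_mem s" by (rule assms(1))
next
  fix s' ws'
  assume "\<exists>i. i + s' 11 = l \<and> reading_at (j + i) s' ws' \<and> same_mem {3, 11, 14, 16, 17} s s'"
    and s': "ok_mem s'" "val top_length s' \<noteq> 0"
  then obtain i l' where i: "i + s' 11 = l" "reading_at (j + i) s' ws'" "same_mem {3, 11, 14, 16, 17} s s'"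
    "s' 11 = Suc l'" by (auto simp: gr0_conv_Suc)
  have "s' 5 = x" "s' 6 = p" using i(3) assms(5,6) by (simp_all add: same_mem_def)
  then have "wp ok_mem consume_letter (\<lambda>s'' ws''. reading_at (Suc (j + i)) s'' ws'' \<and> s'' 11 = l' \<and>
      same_mem {3, 11, 14, 16, 17} s' s'') s' ws'"
    using i s' assms(3) by (intro wp_consume_letter) auto
  then show "wp ok_mem consume_letter (\<lambda>s'' ws''. (\<exists>i. i + s'' 11 = l \<and> reading_at (j + i) s'' ws'' \<and>
      same_mem {3, 11, 14, 16, 17} s s'') \<and> s'' 11 < s' 11) s' ws'"
  proof (rule wp_mono)
    fix s'' ws''
    assume *: "reading_at (Suc (j + i)) s'' ws'' \<and> s'' 11 = l' \<and> same_mem {3, 11, 14, 16, 17} s' s''"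
    have "same_mem {3, 11, 14, 16, 17} s s''"
      by (rule same_mem_trans[OF i(3)]) (use * in auto)
    then show "(\<exists>i. i + s'' 11 = l \<and> reading_at (j + i) s'' ws'' \<and> same_mem {3, 11, 14, 16, 17} s s'') \<and>
        s'' 11 < s' 11"
      using * i by (intro conjI exI[of _ "Suc i"]) auto
  qed
qed auto

lemma digit_div: "d < B \<Longrightarrow> (S * B + d) div B = S"
  and digit_mod: "d < B \<Longrightarrow> (S * B + d) mod B = d"
  by simp_all

lemma wp_pop:
  assumes "ok_mem s" "s 8 = B" "s 13 = stk (Nt A # \<gamma>)" "s 9 = Suc t" "s 19 = Suc c"
    "nc A < B" "length (blk \<gamma>) < B"
  shows "wp ok_mem pop (\<lambda>s' ws'. ws' = ws \<and> s' 9 = t \<and> s' 20 = nc A \<and> s' 13 = stk \<gamma> \<and>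
    s' 11 = length (blk \<gamma>) \<and> s' 12 = hash (blk \<gamma>) \<and> s' 19 = c \<and>
    same_mem {9, 11, 12, 13, 19, 20} s s') s ws"
proof -
  \<comment> \<open>X1 and X2 are what remains of the stack number X0 once the nonterminal, and then
    also the block length, has been divided off.\<close>
  define X2 where "X2 = stk \<gamma> * B + hash (blk \<gamma>)"
  define X1 where "X1 = X2 * B + length (blk \<gamma>)"
  define X0 where "X0 = X1 * B + nc A"
  have s13: "s 13 = X0" using assms(3) by (simp add: X0_def X1_def X2_def)
  have X: "X0 mod B = nc A" "X0 div B = X1" "X1 mod B = length (blk \<gamma>)" "X1 div B = X2"
    "X2 mod B = hash (blk \<gamma>)" "X2 div B = stk \<gamma>"
    unfolding X0_def X1_def X2_def using assms(6,7) hash_less by (simp_all only: digit_div digit_mod)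
  have le: "X0 \<le> M" using bounded_mem_le[OF assms(1), of 13] s13 by simp
  then have le1: "X1 \<le> M" using div_le_trans[of X0 M B] X(2) by simp
  then have le2: "X2 \<le> M" using div_le_trans[of X1 M B] X(4) by simp
  then have le3: "stk \<gamma> \<le> M" using div_le_trans[of X2 M B] X(6) by simp
  have le': "nc A \<le> M" "length (blk \<gamma>) \<le> M" "hash (blk \<gamma>) \<le> M" "t \<le> M" "c \<le> M"
    using assms(6,7) hash_less[of "blk \<gamma>"] B_le_M bounded_mem_le[OF assms(1), of 9]
      bounded_mem_le[OF assms(1), of 19] assms(4,5) by linarith+
  show ?thesis
    unfolding pop_def block.simps
    by (intro wp_Seq wp_Assign wp_Skip;
        simp add: assms(1,2,4,5) s13 X le1 le2 le3 le' same_mem_def)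
qed

text \<open>The relation in force between parse steps: the leading block z has left the stack and is
  part of \<open>predicted\<close>, and equally many input letters have been consumed, whether or
  not they spell z.\<close>

definition conf :: "('n, 't) symbol list \<Rightarrow> (nat \<Rightarrow> nat) \<Rightarrow> 't list \<Rightarrow> bool" where
  "conf y s ws \<longleftrightarrow> s 0 = length w \<and> s 1 = b \<and> s 5 = x \<and> s 6 = p \<and> s 8 = B \<and>
     (\<exists>z \<gamma>. y = map Tm z @ \<gamma> \<and> (\<gamma> = [] \<or> (\<exists>A \<gamma>'. \<gamma> = Nt A # \<gamma>')) \<and> s 13 = stk \<gamma> \<and>
       s 18 = length z + num_terminals \<gamma> \<and> s 19 = num_nonterminals \<gamma> \<and>
       s 15 = hash z \<and> reading_at (length z) s ws)"

lemma stk_Nt_pos: "A \<in> nonterminals G \<Longrightarrow> stk (Nt A # \<gamma>) \<noteq> 0"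
  using nc_range[of A] by simp

lemma predict_iff_ents:
  assumes "y = map Tm z @ Nt A # \<gamma>" "u = take k (drop (length z) w)"
  shows "predicts y y' \<longleftrightarrow> (\<exists>\<alpha>. (A, u, \<alpha>) \<in> set ents \<and> y' = map Tm z @ \<alpha> @ \<gamma> \<and>
    num_nonterminals y' \<le> b \<and> num_terminals y' \<le> length w)"
  unfolding predict_def ents assms by (auto simp: map_Tm_Nt_unique)

lemma ents_unique:
  assumes "(A, u, \<alpha>) \<in> set ents" "(A, u, \<beta>) \<in> set ents"
  shows "\<alpha> = \<beta>"
  using assms LL_unique[OF LL] unfolding ents by blast

text \<open>One iteration is one \<open>predict\<close> step, and \<open>ok\<close> is cleared
  exactly if there is none. A missing table entry and a violated limit both block
  \<open>predict\<close>, the latter because the table entry is unique.\<close>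

lemma wp_parse_step:
  assumes "ok_mem s" "conf y s ws" "set y \<subseteq> Nt ` nonterminals G \<union> Tm ` alphabet G"
    "num_terminals y \<le> length w" "num_nonterminals y \<le> b" "s 13 \<noteq> 0" "s 9 = Suc t" "s 21 = 1" "s 2 = 0"
  shows "wp ok_mem parse_step (\<lambda>s' ws'. s' 9 = t \<and> s' 2 = 0 \<and>
    ((s' 21 = 1 \<and> (\<exists>y'. predicts y y' \<and> conf y' s' ws')) \<or> (s' 21 = 0 \<and> (\<forall>y'. \<not> predicts y y')))) s ws"
    (is "wp ok_mem parse_step ?Q s ws")
proof -
  obtain z \<delta> where y\<delta>: "y = map Tm z @ \<delta>" "\<delta> = [] \<or> (\<exists>A \<gamma>'. \<delta> = Nt A # \<gamma>')" "s 13 = stk \<delta>"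
    "s 18 = length z + num_terminals \<delta>" "s 19 = num_nonterminals \<delta>" "s 15 = hash z" "reading_at (length z) s ws"
    and s: "s 0 = length w" "s 1 = b" "s 5 = x" "s 6 = p" "s 8 = B"
    using assms(2) unfolding conf_def by blast
  have "\<delta> \<noteq> []" using assms(6) y\<delta>(3) by auto
  then obtain A \<gamma> where \<delta>: "\<delta> = Nt A # \<gamma>" using y\<delta>(2) by blast
  define u where "u = take k (drop (length z) w)"
  note y = y\<delta>(1)[unfolded \<delta>]
  have A: "A \<in> nonterminals G" using assms(3) y by auto
  then have ncA: "nc A < B" using nc_range[of A] B_ge(3) by linarith
  have u: "u \<in> lists (alphabet G)"
    using w unfolding u_def by (auto dest: in_set_takeD in_set_dropD)
  have blk: "length (blk \<gamma>) < B"
    using length_blk[of \<gamma>] assms(4) y B_ge(2) by simp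
  have pop: "wp ok_mem pop (\<lambda>s' ws'. ws' = ws \<and> s' 9 = t \<and> s' 20 = nc A \<and> s' 13 = stk \<gamma> \<and>
      s' 11 = length (blk \<gamma>) \<and> s' 12 = hash (blk \<gamma>) \<and> s' 19 = num_nonterminals \<gamma> \<and>
      same_mem {9, 11, 12, 13, 19, 20} s s') s ws"
    using y\<delta>(3,5) s ncA blk assms(1,7) unfolding \<delta> by (intro wp_pop) auto
  define R where "R = Cond (Plus (Minus (Const 1) ok) (Plus (Minus generated vn) (Minus pending vb)))
        (Assign 21 (Const 0))
        (Seq (Assign 15 (Rem (Plus predicted (Times pow top_hash)) modulus))
           (While top_length consume_letter) :: 't prog)"
  have "wp ok_mem (Seq (lookup ents) R) ?Q s1 ws"
    if s1: "ok_mem s1" "s1 9 = t" "s1 20 = nc A" "s1 13 = stk \<gamma>" "s1 11 = length (blk \<gamma>)"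
      "s1 12 = hash (blk \<gamma>)" "s1 19 = num_nonterminals \<gamma>" "same_mem {9, 11, 12, 13, 19, 20} s s1" for s1
  proof -
    have s1': "s1 0 = length w" "s1 1 = b" "s1 2 = 0" "s1 5 = x" "s1 6 = p" "s1 8 = B" "s1 15 = hash z"
      "s1 18 = length z + num_terminals \<gamma>" "s1 21 = 1" "s1 17 = code u"
      "s1 14 = x ^ length z mod p" "s1 16 = hash (take (length z) w)" "ws = drop (length z + k) w"
      using s1(8) s y\<delta> \<delta> assms(8,9) unfolding same_mem_def reading_at_def u_def by simp_all
    have repr: "repr \<gamma> (length z) s1"
      using s1 s1' by (simp add: repr_def)
    have fail: "wp ok_mem R ?Q s2 ws"
      if "ok_mem s2" "s2 9 = t" "s2 2 = 0" "val (Plus (Minus (Const 1) ok) (Plus (Minus generated vn) (Minus pending vb))) s2 \<noteq> 0"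
        "\<And>y'. \<not> predicts y y'" for s2
      unfolding R_def
    proof (rule wp_Cond)
      have "ok_mem (s2(21 := 0))" using that(1) by simp
      then show "wp ok_mem (Assign 21 (Const 0)) ?Q s2 ws"
        using that by (intro wp_Assign) simp_all
    qed (use that in auto)
    show ?thesis
    proof (rule wp_Seq, rule wp_lookup[OF s1(1,3) s1'(10) A u order_refl])
      fix \<alpha> assume \<alpha>: "(A, u, \<alpha>) \<in> set ents"
      then have P: "(A, \<alpha>) \<in> productions G" unfolding ents by blast
      define y' where "y' = map Tm z @ \<alpha> @ \<gamma>"
      have "length \<alpha> \<le> m" using m[OF P] .
      then have bnd: "length z + num_terminals (\<alpha> @ \<gamma>) \<le> length w + m" "num_nonterminals (\<alpha> @ \<gamma>) \<le> b + m"
        using num_le_length[of \<alpha>] assms(4,5) y by simp_all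
      have sym: "set (\<alpha> @ \<gamma>) \<subseteq> Nt ` nonterminals G \<union> Tm ` alphabet G"
      proof -
        have "set \<alpha> \<subseteq> Nt ` nonterminals G \<union> Tm ` alphabet G" using wf P unfolding wf_cfg_def by blast
        then show ?thesis using assms(3) y by simp
      qed
      have pred: "predicts y v \<longleftrightarrow> v = y' \<and> num_nonterminals y' \<le> b \<and> num_terminals y' \<le> length w" for v
        using \<alpha> ents_unique unfolding predict_iff_ents[OF y u_def] y'_def by blast
      show "wp ok_mem (pushes \<alpha>) (wp ok_mem R ?Q) s1 ws"
      proof (rule wp_mono[OF wp_pushes[OF s1(1) repr bnd sym]])
        fix s2 ws2
        assume "ok_mem s2" and "ws2 = ws \<and> repr (\<alpha> @ \<gamma>) (length z) s2 \<and> same_mem {11, 12, 13, 18, 19} s1 s2"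
        then have s2: "ok_mem s2" "ws2 = ws" "repr (\<alpha> @ \<gamma>) (length z) s2" "same_mem {11, 12, 13, 18, 19} s1 s2"
          by auto
        have s2': "s2 0 = length w" "s2 1 = b" "s2 2 = 0" "s2 5 = x" "s2 6 = p" "s2 8 = B" "s2 15 = hash z"
          "s2 21 = 1" "s2 17 = code u" "s2 9 = t"
          "s2 14 = x ^ length z mod p" "s2 16 = hash (take (length z) w)"
          using s2(4) s1' s1(2) unfolding same_mem_def by simp_all
        have s2r: "s2 11 = length (blk (\<alpha> @ \<gamma>))" "s2 12 = hash (blk (\<alpha> @ \<gamma>))" "s2 13 = stk (\<alpha> @ \<gamma>)"
          "s2 18 = length z + num_terminals (\<alpha> @ \<gamma>)" "s2 19 = num_nonterminals (\<alpha> @ \<gamma>)"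
          using s2(3) unfolding repr_def by blast+
        have cnt: "num_terminals y' = s2 18" "num_nonterminals y' = s2 19"
          unfolding s2r y'_def by simp_all
        show "wp ok_mem R ?Q s2 ws2"
        proof (cases "num_nonterminals y' \<le> b \<and> num_terminals y' \<le> length w")
          case False
          then show ?thesis unfolding s2(2)
            using s2 s2' pred by (intro fail) (auto simp: cnt)
        next
          case True
          \<comment> \<open>The new leading block is moved out of the stack; what remains is empty
            or starts with a nonterminal, as \<open>conf\<close> requires.\<close>
          obtain \<eta> where \<eta>: "\<alpha> @ \<gamma> = map Tm (blk (\<alpha> @ \<gamma>)) @ \<eta>" "\<eta> = [] \<or> (\<exists>A \<gamma>'. \<eta> = Nt A # \<gamma>')"
            using blk_split by blast
          define v where "v = blk (\<alpha> @ \<gamma>)"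
          have \<eta>v: "\<alpha> @ \<gamma> = map Tm v @ \<eta>" using \<eta>(1) by (simp add: v_def)
          have len: "length z + length v \<le> length w"
            using True unfolding y'_def \<eta>v by simp
          have hash: "(hash z + (x ^ length z mod p) * hash v) mod p = hash (z @ v)"
          proof -
            have "(hash z + (x ^ length z mod p) * hash v) mod p =
                (horner_sum e x z + x ^ length z * horner_sum e x v) mod p"
              by (intro mod_add_cong mod_mult_eq mod_mod_trivial)
            then show ?thesis by (simp only: horner_sum_append)
          qed
          define s3 where "s3 = s2(15 := hash (z @ v))"
          have s3: "ok_mem s3" unfolding s3_def using s2(1) mod_p_le_M by simp
          have "reading_at (length z) s3 ws" "s3 11 = length v" "s3 5 = x" "s3 6 = p"
            using s2' s2r s1' by (simp_all add: s3_def reading_at_def u_def v_def)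
          then have consume: "wp ok_mem (While top_length consume_letter)
              (\<lambda>s' ws'. reading_at (length z + length v) s' ws' \<and> same_mem {3, 11, 14, 16, 17} s3 s') s3 ws"
            using s3 len by (intro wp_consume) auto
          have Q: "?Q s4 ws4"
            if "reading_at (length z + length v) s4 ws4 \<and> same_mem {3, 11, 14, 16, 17} s3 s4" for s4 ws4
          proof -
            have s4: "s4 0 = length w" "s4 1 = b" "s4 2 = 0" "s4 5 = x" "s4 6 = p" "s4 8 = B"
              "s4 21 = 1" "s4 9 = t" "s4 15 = hash (z @ v)" "s4 13 = stk \<eta>"
              "s4 18 = length (z @ v) + num_terminals \<eta>" "s4 19 = num_nonterminals \<eta>"
              using that s2' s2r unfolding same_mem_def s3_def \<eta>v by simp_all
            have "conf y' s4 ws4"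
              unfolding conf_def
              using s4 that \<eta>(2) by (intro conjI exI[of _ "z @ v"] exI[of _ \<eta>]) (simp_all add: y'_def \<eta>v)
            then show ?thesis using s4 True pred by blast
          qed
          show ?thesis unfolding s2(2) R_def
          proof (rule wp_Cond)
            show "ok_mem s2" by (rule s2(1))
          next
            assume "val (Plus (Minus (Const 1) ok) (Plus (Minus generated vn) (Minus pending vb))) s2 \<noteq> 0"
            then show "wp ok_mem (Assign 21 (Const 0)) ?Q s2 ws"
              using True s2' cnt by simp
          next
            have val: "val (Rem (Plus predicted (Times pow top_hash)) modulus) s2 = hash (z @ v)"
              using hash s2' s2r by (simp add: v_def)
            have "wp ok_mem (While top_length consume_letter) ?Q s3 ws"
              by (rule wp_mono[OF consume]) (rule Q)
            then show "wp ok_mem (Seq (Assign 15 (Rem (Plus predicted (Times pow top_hash)) modulus))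
                (While top_length consume_letter)) ?Q s2 ws"
              using s2(1) s3 unfolding s3_def by (intro wp_Seq wp_Assign; simp only: val)
          qed
        qed
      qed
    next
      assume none: "\<And>\<alpha>. (A, u, \<alpha>) \<notin> set ents"
      have "ok_mem (s1(21 := 0))" using s1(1) by simp
      then show "wp ok_mem R ?Q (s1(21 := 0)) ws"
        using s1(2) s1'(3) none by (intro fail) (simp_all add: predict_iff_ents[OF y u_def])
    qed
  qed
  then show ?thesis
    unfolding parse_step_def R_def[symmetric]
    by (intro wp_Seq[of _ pop] wp_mono[OF pop]) blast
qed

text \<open>As p is the least prime from the start value on, the candidate never passes it, which
  bounds both the memory and the search.\<close>

lemma wp_search_prime:
  assumes "ok_mem s" "prime p" "2 \<le> s 4 + W" "s 4 + W \<le> p"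
    "\<And>r. prime r \<Longrightarrow> s 4 + W \<le> r \<Longrightarrow> p \<le> r"
  shows "wp ok_mem search_prime (\<lambda>s' ws'. ws' = ws \<and> s' 6 = p \<and> same_mem {6, 7} s s') s ws"
proof -
  define Inv where "Inv s' ws' \<longleftrightarrow> ws' = ws \<and> same_mem {6, 7} s s' \<and> s 4 + W \<le> s' 6 \<and> s' 6 \<le> p \<and>
    2 \<le> s' 7 \<and> s' 7 \<le> s' 6 \<and> (\<forall>j. 2 \<le> j \<and> j < s' 7 \<longrightarrow> \<not> j dvd s' 6)" for s' and ws' :: "'t list"
  \<comment> \<open>Lexicographic descent in candidate and divisor, packed into one number: the
    divisor part stays below p + 1.\<close>
  define mu where "mu s = (p - s 6) * (p + 1) + (p + 1 - s 7)" for s :: "nat \<Rightarrow> nat"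
  have pM: "p \<le> M" using B_ge(1) B_le_M by simp
  have init: "Inv (s(6 := s 4 + W, 7 := 2)) ws" using assms(3,4) by (auto simp: Inv_def same_mem_def)
  have "2 \<le> M" using B_ge(5) B_le_M by simp
  have loop: "wp ok_mem (While (Minus modulus divisor)
       (Cond (Rem modulus divisor)
          (Assign 7 (Plus divisor (Const 1)))
          (Seq (Assign 6 (Plus modulus (Const 1))) (Assign 7 (Const 2)))))
     (\<lambda>s' ws'. ws' = ws \<and> s' 6 = p \<and> same_mem {6, 7} s s') s1 ws1"
    if s1: "ok_mem s1" "Inv s1 ws1" for s1 ws1
  proof (rule wp_While[where Inv = Inv and m = mu])
    fix s' and ws' :: "'t list"
    assume I: "Inv s' ws'" "ok_mem s'" "val (Minus modulus divisor) s' \<noteq> 0"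
    then have lt: "s' 7 < s' 6" by simp
    note I' = I(1)[unfolded Inv_def]
    show "wp ok_mem (Cond (Rem modulus divisor)
          (Assign 7 (Plus divisor (Const 1)))
          (Seq (Assign 6 (Plus modulus (Const 1))) (Assign 7 (Const 2))))
       (\<lambda>s'' ws''. Inv s'' ws'' \<and> mu s'' < mu s') s' ws'"
    proof (rule wp_Cond)
      assume "val (Rem modulus divisor) s' \<noteq> 0"
      then have nd: "\<not> s' 7 dvd s' 6" by (simp add: dvd_eq_mod_eq_0)
      then have "Inv (s'(7 := Suc (s' 7))) ws'"
        using I' lt by (auto simp: Inv_def same_mem_def less_Suc_eq)
      moreover have "Suc (s' 7) \<le> M" using lt I' pM by simp
      moreover have "mu (s'(7 := Suc (s' 7))) < mu s'"
        unfolding mu_def using lt I' by (intro add_le_less_mono) auto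
      ultimately show "wp ok_mem (Assign 7 (Plus divisor (Const 1)))
          (\<lambda>s'' ws''. Inv s'' ws'' \<and> mu s'' < mu s') s' ws'"
        using I(2) lt I' by (intro wp_Assign) simp_all
    next
      assume "val (Rem modulus divisor) s' = 0"
      then have "s' 7 dvd s' 6" by (simp add: dvd_eq_mod_eq_0)
      then have "\<not> prime (s' 6)" using lt I' by (auto simp: prime_nat_iff)
      then have less: "s' 6 < p" using I' assms(2) by (metis le_neq_implies_less)
      then have inv: "Inv (s'(6 := Suc (s' 6), 7 := 2)) ws'"
        using I' assms(3) by (auto simp: Inv_def same_mem_def)
      obtain d where d: "p - s' 6 = Suc d" "p - Suc (s' 6) = d" using less
        by (metis Suc_diff_Suc)
      have dec: "mu (s'(6 := Suc (s' 6), 7 := 2)) < mu s'"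
        unfolding mu_def using d p1 by simp
      have M: "Suc (s' 6) \<le> M" using less pM by simp
      show "wp ok_mem (Seq (Assign 6 (Plus modulus (Const 1))) (Assign 7 (Const 2)))
          (\<lambda>s'' ws''. Inv s'' ws'' \<and> mu s'' < mu s') s' ws'"
        using I(2) M inv dec \<open>2 \<le> M\<close> by (intro wp_Seq wp_Assign) simp_all
    qed (use I in simp_all)
  next
    fix s' and ws' :: "'t list"
    assume I: "Inv s' ws'" "val (Minus modulus divisor) s' = 0"
    note I' = I(1)[unfolded Inv_def]
    have eq: "s' 7 = s' 6" using I(2) I' by simp
    have "prime (s' 6)"
      unfolding prime_nat_iff
    proof (intro conjI allI impI)
      show "1 < s' 6" using I' by simp
      fix j assume j: "j dvd s' 6"
      then have "j \<noteq> 0" "j \<le> s' 6" using I' by (auto intro: dvd_imp_le)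
      moreover have "\<not> (2 \<le> j \<and> j < s' 6)" using I' j eq by auto
      ultimately show "j = 1 \<or> j = s' 6" by linarith
    qed
    then have "p \<le> s' 6" using assms(5)[of "s' 6"] I' by blast
    then show "ws' = ws \<and> s' 6 = p \<and> same_mem {6, 7} s s'" using I' by simp
  qed (use s1 in simp_all)
  have "s 4 + W \<le> M" using assms(4) pM by simp
  moreover have "ok_mem (s(6 := s 4 + W, 7 := 2))"
    using assms(1) \<open>s 4 + W \<le> M\<close> \<open>2 \<le> M\<close> by simp
  note ok = this
  have "wp ok_mem (While (Minus modulus divisor)
       (Cond (Rem modulus divisor)
          (Assign 7 (Plus divisor (Const 1)))
          (Seq (Assign 6 (Plus modulus (Const 1))) (Assign 7 (Const 2)))))
     (wp ok_mem Skip (\<lambda>s' ws'. ws' = ws \<and> s' 6 = p \<and> same_mem {6, 7} s s')) (s(6 := s 4 + W, 7 := 2)) ws"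
    by (rule wp_mono[OF loop[OF ok init]]) (rule wp_Skip)
  ultimately show ?thesis
    unfolding search_prime_def block.simps
    using assms(1) \<open>2 \<le> M\<close>
    by (intro wp_Seq wp_Assign) simp_all
qed

lemma wp_fill:
  assumes "ok_mem s" "s 17 = 0"
  shows "j \<le> k \<Longrightarrow> wp ok_mem (fill j)
    (\<lambda>s' ws'. s' 17 = code (take j w) \<and> ws' = drop j w \<and> same_mem {3, 17} s s') s w"
proof (induction j)
  case 0
  then show ?case using assms by (auto intro!: wp_Skip simp: code_def same_mem_def)
next
  case (Suc j)
  show ?case unfolding fill.simps
  proof (rule wp_Seq, rule wp_mono)
    show "wp ok_mem (fill j) (\<lambda>s' ws'. s' 17 = code (take j w) \<and> ws' = drop j w \<and> same_mem {3, 17} s s') s w"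
      using Suc by simp
    fix s' ws' assume s': "ok_mem s'" "s' 17 = code (take j w) \<and> ws' = drop j w \<and> same_mem {3, 17} s s'"
    define r where "r = table (if ws' = [] then None else Some (hd ws'))"
    have "r \<le> M" unfolding r_def
      using w set_drop_subset[of j w] s'(2) by (intro table_le_M) (cases "drop j w"; auto)
    have code: "code (take j w) + r * W ^ j = code (take (Suc j) w)"
      using s'(2) by (cases "j < length w")
        (simp_all add: r_def take_Suc_conv_app_nth code_def table_def hd_drop_conv_nth horner_sum_append)
    have "code (take (Suc j) w) \<le> M"
      using w Suc.prems by (intro window_le_M) (auto dest: in_set_takeD)
    moreover have s17: "s' 17 = code (take j w)" and s'_same: "same_mem {3, 17} s s'" using s'(2) by auto
    moreover have "tl ws' = drop (Suc j) w" using s'(2) by (simp add: drop_Suc tl_drop)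
    ultimately show "wp ok_mem (Seq (Read 3 table) (Assign 17 (Plus window (Times tmp (Const (W ^ j))))))
        (\<lambda>s' ws'. s' 17 = code (take (Suc j) w) \<and> ws' = drop (Suc j) w \<and> same_mem {3, 17} s s') s' ws'"
      using s'(1) s17 s'_same \<open>r \<le> M\<close> code
      by (intro wp_Seq wp_Read wp_Assign; simp add: r_def[symmetric] same_mem_def)
  qed
qed

definition fuel0 :: nat where "fuel0 = B ^ (2 * (b + 1))"

lemma wp_init_parse:
  assumes "ok_mem s" "s 0 = length w" "s 1 = b" "s 5 = x" "s 6 = p"
    "\<And>v. v \<in> {2, 11, 12, 15, 16, 17, 18} \<Longrightarrow> s v = 0"
  shows "wp ok_mem init_parse
    (\<lambda>s' ws'. conf [Nt (start G)] s' ws' \<and> s' 9 = fuel0 \<and> s' 21 = 1 \<and> s' 2 = 0) s w"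
proof -
  define s1 where "s1 = s(8 := B, 9 := B * B, 10 := b)"
  have BB: "B ^ (2 * i) \<le> M" if "i \<le> b + 1" for i using that by (intro B_power_le_M) simp
  have BB1: "B * B \<le> M" using BB[of 1] by (simp add: power2_eq_square)
  have b_le: "b \<le> M" using bm_le_M by simp
  have s1: "ok_mem s1" using assms(1) B_le_M BB1 b_le by (simp add: s1_def)
  have loop: "wp ok_mem (While counter (Seq (Assign 9 (Times fuel (Times base base))) (Assign 10 (Minus counter (Const 1)))))
     (\<lambda>s' ws'. ws' = w \<and> s' 9 = fuel0 \<and> same_mem {9, 10} s1 s') s1 w"
  proof (rule wp_While[where m = "\<lambda>s. s 10" and
        Inv = "\<lambda>s' ws'. ws' = w \<and> (\<exists>i. i + s' 10 = b + 1 \<and> s' 9 = B ^ (2 * i)) \<and> same_mem {9, 10} s1 s'"])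
    show "w = w \<and> (\<exists>i. i + s1 10 = b + 1 \<and> s1 9 = B ^ (2 * i)) \<and> same_mem {9, 10} s1 s1"
      by (auto simp: s1_def same_mem_def power2_eq_square intro!: exI[of _ 1])
  next
    fix s' and ws' :: "'t list"
    assume "ws' = w \<and> (\<exists>i. i + s' 10 = b + 1 \<and> s' 9 = B ^ (2 * i)) \<and> same_mem {9, 10} s1 s'"
      and s': "ok_mem s'" "val counter s' \<noteq> 0"
    then obtain i j where i: "i + s' 10 = b + 1" "s' 9 = B ^ (2 * i)" "same_mem {9, 10} s1 s'" "ws' = w"
      "s' 10 = Suc j" by (auto simp: gr0_conv_Suc)
    have s'8: "s' 8 = B" using i(3) by (simp add: same_mem_def s1_def)
    have eq: "B ^ (2 * i) * (B * B) = B ^ (2 * Suc i)" by (simp add: power_add power2_eq_square)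
    have "B ^ (2 * Suc i) \<le> M" using i by (intro BB) simp
    moreover have "j \<le> M" using i b_le by simp
    ultimately have *: "ok_mem (s'(9 := B ^ (2 * Suc i)))" "ok_mem (s'(9 := B ^ (2 * Suc i), 10 := j))"
      using s'(1) by simp_all
    have "\<exists>i'. i' + j = b + 1 \<and> B ^ (2 * Suc i) = B ^ (2 * i')" using i by (intro exI[of _ "Suc i"]) simp
    then show "wp ok_mem (Seq (Assign 9 (Times fuel (Times base base))) (Assign 10 (Minus counter (Const 1))))
       (\<lambda>s'' ws''. (ws'' = w \<and> (\<exists>i. i + s'' 10 = b + 1 \<and> s'' 9 = B ^ (2 * i)) \<and> same_mem {9, 10} s1 s'') \<and>
          s'' 10 < s' 10) s' ws'"
      using * s'(1) i s'8 eq
      by (intro wp_Seq wp_Assign; simp add: same_mem_def del: power_Suc mult_Suc_right)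
  next
    fix s' and ws' :: "'t list"
    assume "ws' = w \<and> (\<exists>i. i + s' 10 = b + 1 \<and> s' 9 = B ^ (2 * i)) \<and> same_mem {9, 10} s1 s'"
      "val counter s' = 0"
    then show "ws' = w \<and> s' 9 = fuel0 \<and> same_mem {9, 10} s1 s'" by (auto simp: fuel0_def)
  qed (rule s1)
  have nc: "nc (start G) \<le> M" using nc_range[of "start G"] wf B_ge(3) B_le_M by (simp add: wf_cfg_def)
  have M1: "1 \<le> M" using B_ge(5) B_le_M by simp
  show ?thesis
    unfolding init_parse_def block.simps
  proof (intro wp_Seq[of _ "Assign 8 _"] wp_Seq[of _ "Assign 9 _"] wp_Seq[of _ "Assign 10 _"] wp_Assign)
    have B: "val (Plus modulus (Const cst)) s = B" using assms(5) by (simp add: B_def)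
    have BB: "val (Times base base) (s(8 := B)) = B * B" by simp
    have bb: "val vb (s(8 := B, 9 := B * B)) = b" using assms(3) by simp
    note vals = B BB bb
    show "ok_mem s" by (rule assms(1))
    show "ok_mem (s(8 := val (Plus modulus (Const cst)) s))" unfolding vals using assms(1) B_le_M by simp
    then show "ok_mem (s(8 := val (Plus modulus (Const cst)) s))" .
    show "ok_mem (s(8 := val (Plus modulus (Const cst)) s, 9 := val (Times base base) (s(8 := val (Plus modulus (Const cst)) s))))"
      unfolding vals using assms(1) B_le_M BB1 by simp
    then show "ok_mem (s(8 := val (Plus modulus (Const cst)) s, 9 := val (Times base base) (s(8 := val (Plus modulus (Const cst)) s))))" .
    show "ok_mem (s(8 := val (Plus modulus (Const cst)) s, 9 := val (Times base base) (s(8 := val (Plus modulus (Const cst)) s)),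
        10 := val vb (s(8 := val (Plus modulus (Const cst)) s, 9 := val (Times base base) (s(8 := val (Plus modulus (Const cst)) s))))))"
      unfolding vals using s1 by (simp add: s1_def)
    show "wp ok_mem (Seq (While counter (Seq (Assign 9 (Times fuel (Times base base))) (Assign 10 (Minus counter (Const 1)))))
        (Seq (Assign 13 (Const (nc (start G)))) (Seq (Assign 14 (Const 1)) (Seq (Assign 19 (Const 1))
        (Seq (Assign 21 (Const 1)) (Seq (fill k) Skip))))))
      (\<lambda>s' ws'. conf [Nt (start G)] s' ws' \<and> s' 9 = fuel0 \<and> s' 21 = 1 \<and> s' 2 = 0)
      (s(8 := val (Plus modulus (Const cst)) s, 9 := val (Times base base) (s(8 := val (Plus modulus (Const cst)) s)),
        10 := val vb (s(8 := val (Plus modulus (Const cst)) s, 9 := val (Times base base) (s(8 := val (Plus modulus (Const cst)) s)))))) w"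
      unfolding vals s1_def[symmetric]
    proof (rule wp_Seq, rule wp_mono[OF loop])
      fix s2 ws2
      assume s2: "ok_mem s2" "ws2 = w \<and> s2 9 = fuel0 \<and> same_mem {9, 10} s1 s2"
      define s3 where "s3 = s2(13 := nc (start G), 14 := 1, 19 := 1, 21 := 1)"
      have s3: "ok_mem s3" unfolding s3_def using s2(1) nc M1 by simp
      have "s3 17 = 0" using s2(2) assms(6) by (simp add: s3_def same_mem_def s1_def)
      from wp_fill[OF s3 this order_refl]
      have "wp ok_mem (Seq (fill k) Skip)
          (\<lambda>s' ws'. conf [Nt (start G)] s' ws' \<and> s' 9 = fuel0 \<and> s' 21 = 1 \<and> s' 2 = 0) s3 w"
      proof (intro wp_Seq, elim wp_mono, intro wp_Skip)
        fix s4 ws4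
        assume s4: "s4 17 = code (take k w) \<and> ws4 = drop k w \<and> same_mem {3, 17} s3 s4"
        have eqs: "s4 0 = length w" "s4 1 = b" "s4 5 = x" "s4 6 = p" "s4 8 = B" "s4 13 = nc (start G)"
          "s4 14 = 1" "s4 19 = 1" "s4 18 = 0" "s4 15 = 0" "s4 16 = 0" "s4 9 = fuel0" "s4 21 = 1" "s4 2 = 0"
          using s4 s2(2) assms(2-6) by (simp_all add: s3_def same_mem_def s1_def)
        have "conf [Nt (start G)] s4 ws4"
          unfolding conf_def reading_at_def
          using eqs s4 p1 by (intro conjI exI[of _ "[]"] exI[of _ "[Nt (start G)]"]) simp_all
        then show "conf [Nt (start G)] s4 ws4 \<and> s4 9 = fuel0 \<and> s4 21 = 1 \<and> s4 2 = 0" using eqs by simp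
      qed
      then show "wp ok_mem (Seq (Assign 13 (Const (nc (start G)))) (Seq (Assign 14 (Const 1)) (Seq (Assign 19 (Const 1))
        (Seq (Assign 21 (Const 1)) (Seq (fill k) Skip)))))
        (\<lambda>s' ws'. conf [Nt (start G)] s' ws' \<and> s' 9 = fuel0 \<and> s' 21 = 1 \<and> s' 2 = 0) s2 ws2"
        using s2 nc M1 unfolding s3_def
        by (intro wp_Seq[of _ "Assign 13 _"] wp_Seq[of _ "Assign 14 _"] wp_Seq[of _ "Assign 19 _"]
            wp_Seq[of _ "Assign 21 _"] wp_Assign; simp only: val.simps bounded_mem_upd; simp)
    qed
  qed
qed

abbreviation initial :: "('n, 't) symbol list" where "initial \<equiv> [Nt (start G)]"

lemma predicts_invariant:
  assumes "(predicts ^^ i) initial y"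
  shows "set y \<subseteq> Nt ` nonterminals G \<union> Tm ` alphabet G \<and> num_terminals y \<le> length w \<and> num_nonterminals y \<le> b"
proof -
  have "predicts\<^sup>*\<^sup>* initial y" using assms by (rule relpowp_imp_rtranclp)
  then show ?thesis
  proof (induction rule: rtranclp_induct)
    case base
    then show ?case using wf b by (auto simp: wf_cfg_def)
  next
    case (step y z)
    then show ?case using predict_symbols[OF wf step.hyps(2)] unfolding predict_def by blast
  qed
qed

text \<open>In the count of shapes, one factor \<open>B ^ 2\<close> covers the input position and
  one further factor each of the b possible stack entries.\<close>

lemma fuel0_bound:
  assumes "predicts\<^sup>*\<^sup>* initial (map Tm w)" "(predicts ^^ i) initial y"
  shows "i < fuel0"
proof -
  have "length w + 1 \<le> B" "card (nonterminals G) + 1 \<le> B" using B_ge by simp_all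
  then have "(card (nonterminals G) + 1) * (length w + 1) \<le> B * B" by (intro mult_mono) auto
  then have "Suc (card (nonterminals G) * Suc (length w)) \<le> B ^ 2" by (simp add: power2_eq_square)
  moreover have "Suc (length w) \<le> B ^ 2"
    using \<open>length w + 1 \<le> B\<close> B_ge(5) by (simp add: power2_eq_square) (metis le_trans mult_le_mono1 nat_mult_1 one_le_numeral)
  ultimately have "Suc (length w) * Suc (card (nonterminals G) * Suc (length w)) ^ b \<le> B ^ 2 * (B ^ 2) ^ b"
    by (intro mult_mono power_mono) auto
  also have "\<dots> = fuel0" by (simp add: fuel0_def power_mult[symmetric] power_add[symmetric])
  finally show ?thesis using predict_length_bound[OF wf LL b assms] by linarith
qed

text \<open>By determinism a successful run would have to pass through y and leave it again.\<close>

lemma not_good_if_stuck: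
  assumes "(predicts ^^ i) initial y" "\<And>y'. \<not> predicts y y'" "\<And>v. y \<noteq> map Tm v"
  shows "\<not> predicts\<^sup>*\<^sup>* initial (map Tm w)"
proof
  assume "predicts\<^sup>*\<^sup>* initial (map Tm w)"
  moreover have "predicts\<^sup>*\<^sup>* initial y" using assms(1) by (rule relpowp_imp_rtranclp)
  ultimately have "predicts\<^sup>*\<^sup>* y (map Tm w)"
    using deterministic_rtranclp_stuck[of predicts "map Tm w" initial y] predict_deterministic[OF LL] predict_map_Tm
    by blast
  then show False using assms(2,3) by (metis converse_rtranclpE)
qed

text \<open>The event that the final comparison cannot tell the predicted word from w. The case v =
  w is included, so acceptance implies a collision for good inputs too.\<close>

definition collision :: bool where
  "collision \<longleftrightarrow> (\<exists>v. predicts\<^sup>*\<^sup>* initial (map Tm v) \<and> length v = length w \<and> hash v = hash w)"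

lemma wp_parse:
  assumes "ok_mem s" "s 0 = length w" "s 1 = b" "s 5 = x" "prime p" "2 \<le> s 4 + W" "s 4 + W \<le> p"
    "\<And>r. prime r \<Longrightarrow> s 4 + W \<le> r \<Longrightarrow> p \<le> r" "\<And>v. v \<notin> {0, 1, 3, 4, 5} \<Longrightarrow> s v = 0"
  shows "wp ok_mem parse (\<lambda>s' ws'. (predicts\<^sup>*\<^sup>* initial (map Tm w) \<longrightarrow> s' 2 \<noteq> 0) \<and> (s' 2 \<noteq> 0 \<longrightarrow> collision)) s w"
    (is "wp ok_mem parse ?Q s w")
proof -
  \<comment> \<open>The fuel spent counts the \<open>predict\<close> steps made. Once
    \<open>ok\<close> is cleared, only the verdict that w is unreachable is kept.\<close>
  define Inv where "Inv s ws \<longleftrightarrow> s 2 = 0 \<and> s 9 \<le> fuel0 \<and>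
    ((s 21 = 1 \<and> (\<exists>y. (predicts ^^ (fuel0 - s 9)) initial y \<and> conf y s ws)) \<or>
     (s 21 = 0 \<and> \<not> predicts\<^sup>*\<^sup>* initial (map Tm w)))" for s ws
  define F where "F = Cond (Plus (Minus (Const 1) ok) (Plus stack (Plus (Differ generated vn) (Differ predicted actual))))
           Skip (Assign 2 (Const 1) :: 't prog)"
  have final: "wp ok_mem F ?Q s1 ws1"
    if fin: "ok_mem s1" "Inv s1 ws1" "val (Times fuel (Times stack ok)) s1 = 0" for s1 ws1
  proof (cases "s1 21 = 0")
    case True
    then have "\<not> predicts\<^sup>*\<^sup>* initial (map Tm w)" "s1 2 = 0" using fin(2) by (auto simp: Inv_def)
    then show ?thesis unfolding F_def using True fin(1) by (intro wp_Cond wp_Skip) auto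
  next
    case False
    then obtain y where y: "(predicts ^^ (fuel0 - s1 9)) initial y" "conf y s1 ws1" and s1: "s1 21 = 1" "s1 2 = 0" "s1 9 \<le> fuel0"
      using fin(2) by (auto simp: Inv_def)
    obtain z \<gamma> where \<gamma>: "y = map Tm z @ \<gamma>" "\<gamma> = [] \<or> (\<exists>A \<gamma>'. \<gamma> = Nt A # \<gamma>')" "s1 13 = stk \<gamma>"
      "s1 18 = length z + num_terminals \<gamma>" "s1 15 = hash z" "s1 16 = hash (take (length z) w)" "s1 0 = length w"
      using y(2) unfolding conf_def reading_at_def by blast
    have reach: "predicts\<^sup>*\<^sup>* initial y" using y(1) by (rule relpowp_imp_rtranclp)
    show ?thesis
    proof (cases "s1 13 = 0")
      case False
      \<comment> \<open>The fuel is spent although the stack is not empty: if w were reachable, a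
        form reached after \<open>fuel0\<close> steps would contradict
        \<open>fuel0_bound\<close>.\<close>
      then have "s1 9 = 0" using fin(3) s1 by simp
      then have "\<not> predicts\<^sup>*\<^sup>* initial (map Tm w)" using fuel0_bound y(1) by fastforce
      then show ?thesis unfolding F_def using False fin(1) s1 by (intro wp_Cond wp_Skip) auto
    next
      case True
      \<comment> \<open>Nonterminal codes are positive, so stack value 0 means that no nonterminal
        is left.\<close>
      have "\<gamma> = []"
      proof (rule ccontr)
        assume "\<gamma> \<noteq> []"
        then obtain A \<gamma>' where A: "\<gamma> = Nt A # \<gamma>'" using \<gamma>(2) by blast
        then have "A \<in> nonterminals G" using predicts_invariant[OF y(1)] \<gamma>(1) by auto
        then show False using stk_Nt_pos True \<gamma>(3) A by metis
      qed
      then have yz: "y = map Tm z" using \<gamma>(1) by simp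
      have good: "z = w" if good_w: "predicts\<^sup>*\<^sup>* initial (map Tm w)"
      proof -
        have "predicts\<^sup>*\<^sup>* (map Tm z) (map Tm w)"
          using deterministic_rtranclp_stuck[of predicts "map Tm w" initial y] predict_deterministic[OF LL]
            predict_map_Tm good_w reach unfolding yz by blast
        then have "(map Tm z :: ('n, 't) symbol list) = map Tm w" using predict_map_Tm by (metis converse_rtranclpE)
        then show ?thesis by (simp add: inj_on_def inj_map_eq_map)
      qed
      have M1: "1 \<le> M" using B_ge(5) B_le_M by simp
      show ?thesis unfolding F_def
      proof (rule wp_Cond)
        assume "val (Plus (Minus (Const 1) ok) (Plus stack (Plus (Differ generated vn) (Differ predicted actual)))) s1 \<noteq> 0"
        then have "z \<noteq> w" using s1 True \<gamma> \<open>\<gamma> = []\<close> by auto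
        then show "wp ok_mem Skip ?Q s1 ws1" using good fin(1) s1 by (intro wp_Skip) auto
      next
        assume "val (Plus (Minus (Const 1) ok) (Plus stack (Plus (Differ generated vn) (Differ predicted actual)))) s1 = 0"
        then have "length z = length w" "hash z = hash (take (length z) w)" using \<gamma> \<open>\<gamma> = []\<close> by auto
        then have collision unfolding collision_def using reach yz by auto
        moreover have "ok_mem (s1(2 := 1))" using fin(1) M1 by simp
        ultimately show "wp ok_mem (Assign 2 (Const 1)) ?Q s1 ws1"
          using fin(1) by (intro wp_Assign) simp_all
      qed (rule fin(1))
    qed
  qed
  have step: "wp ok_mem parse_step (\<lambda>s' ws'. Inv s' ws' \<and> s' 9 < s1 9) s1 ws1"
    if cont: "Inv s1 ws1" "ok_mem s1" "val (Times fuel (Times stack ok)) s1 \<noteq> 0" for s1 ws1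
  proof -
    obtain y where y: "(predicts ^^ (fuel0 - s1 9)) initial y" "conf y s1 ws1" and s1: "s1 21 = 1" "s1 2 = 0" "s1 9 \<le> fuel0"
      using cont(1,3) by (auto simp: Inv_def)
    obtain t where t: "s1 9 = Suc t" using cont(3) by (cases "s1 9") auto
    have "s1 13 \<noteq> 0" using cont(3) by auto
    note inv = predicts_invariant[OF y(1)]
    obtain z \<gamma> where \<gamma>: "y = map Tm z @ \<gamma>" "\<gamma> = [] \<or> (\<exists>A \<gamma>'. \<gamma> = Nt A # \<gamma>')" "s1 13 = stk \<gamma>"
      using y(2) unfolding conf_def by blast
    then obtain A \<gamma>' where A: "\<gamma> = Nt A # \<gamma>'" using \<open>s1 13 \<noteq> 0\<close> by auto
    have nT: "y \<noteq> map Tm v" for v unfolding \<gamma>(1) A by (rule map_Tm_Nt_neq_map_Tm)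
    have fuel: "fuel0 - t = Suc (fuel0 - s1 9)" using t s1(3) by simp
    have "wp ok_mem parse_step (\<lambda>s' ws'. s' 9 = t \<and> s' 2 = 0 \<and>
      ((s' 21 = 1 \<and> (\<exists>y'. predicts y y' \<and> conf y' s' ws')) \<or> (s' 21 = 0 \<and> (\<forall>y'. \<not> predicts y y')))) s1 ws1"
      using cont(2) y(2) inv \<open>s1 13 \<noteq> 0\<close> t s1 by (intro wp_parse_step) auto
    then show ?thesis
    proof (rule wp_mono)
      fix s' ws'
      assume *: "s' 9 = t \<and> s' 2 = 0 \<and>
        ((s' 21 = 1 \<and> (\<exists>y'. predicts y y' \<and> conf y' s' ws')) \<or> (s' 21 = 0 \<and> (\<forall>y'. \<not> predicts y y')))"
      then consider y' where "s' 21 = 1" "predicts y y'" "conf y' s' ws'"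
        | "s' 21 = 0" "\<And>y'. \<not> predicts y y'" by auto
      then show "Inv s' ws' \<and> s' 9 < s1 9"
      proof cases
        case 1
        have "(predicts ^^ (fuel0 - t)) initial y'" unfolding fuel using y(1) 1(2) by (rule relpowp_Suc_I)
        then show ?thesis using * 1 t s1(3) unfolding Inv_def by auto
      next
        case 2
        then show ?thesis using * t s1(3) not_good_if_stuck[OF y(1) _ nT] unfolding Inv_def by auto
      qed
    qed
  qed
  have loop: "wp ok_mem (While (Times fuel (Times stack ok)) parse_step)
      (wp ok_mem F ?Q) s1 ws1" if "ok_mem s1" "Inv s1 ws1" for s1 ws1
    using that by (intro wp_While[where Inv = Inv and m = "\<lambda>s. s 9"] step final)
  have prepared: "wp ok_mem init_parse
      (wp ok_mem (Seq (While (Times fuel (Times stack ok)) parse_step) F) ?Q) s1 w"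
    if s1: "ok_mem s1" "s1 6 = p" "same_mem {6, 7} s s1" for s1
  proof (rule wp_mono[OF wp_init_parse])
    show "ok_mem s1" by (rule s1)
    show "s1 0 = length w" "s1 1 = b" "s1 5 = x" "s1 6 = p" using s1 assms(2-4) by (simp_all add: same_mem_def)
    show "s1 v = 0" if "v \<in> {2, 11, 12, 15, 16, 17, 18}" for v
      using s1(3) that assms(9)[of v] by (auto simp: same_mem_def)
    fix s2 ws2
    assume s2: "ok_mem s2" "conf initial s2 ws2 \<and> s2 9 = fuel0 \<and> s2 21 = 1 \<and> s2 2 = 0"
    then have "Inv s2 ws2" unfolding Inv_def by auto
    then show "wp ok_mem (Seq (While (Times fuel (Times stack ok)) parse_step) F) ?Q s2 ws2"
      using s2(1) by (intro wp_Seq loop)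
  qed
  show ?thesis
    unfolding parse_def F_def[symmetric]
  proof (rule wp_Seq, rule wp_mono[OF wp_search_prime[OF assms(1,5-8)]])
    fix s1 ws1 assume "ok_mem s1" "ws1 = w \<and> s1 6 = p \<and> same_mem {6, 7} s s1"
    then show "wp ok_mem (Seq init_parse (Seq (While (Times fuel (Times stack ok)) parse_step) F)) ?Q s1 ws1"
      using prepared by (intro wp_Seq) simp
  qed
qed

end

section \<open>Acceptance, rejection and space from outcomes\<close>

lemma outcome_mono: "outcome I A r c \<Longrightarrow> r' \<le> r \<Longrightarrow> outcome I A r' c"
  unfolding outcome_def by (meson order_trans)

lemma outcome_accept_prob:
  assumes "outcome I True r (init p b w)"
  shows "accept_prob p b w = 1"
proof -
  obtain t where "set_pmf (steps t (init p b w)) \<subseteq> accepting"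
    using assms unfolding outcome_def by blast
  then have "measure_pmf.prob (steps t (init p b w)) accepting = 1"
    by (subst measure_pmf.prob_eq_1) (auto simp: AE_measure_pmf_iff)
  then have "1 \<le> accept_prob p b w"
    unfolding accept_prob_def
    by (intro cSUP_upper2[of _ _ t] bdd_aboveI2[of _ _ 1]) auto
  moreover have "accept_prob p b w \<le> 1"
    unfolding accept_prob_def by (intro cSUP_least) auto
  ultimately show ?thesis by simp
qed

lemma outcome_reject_prob:
  assumes "outcome I A r (init p b w)"
  shows "r \<le> reject_prob p b w"
proof -
  obtain t where "r \<le> measure_pmf.prob (steps t (init p b w)) rejecting"
    using assms unfolding outcome_def by blast
  then show ?thesis
    unfolding reject_prob_def
    by (intro cSUP_upper2[of _ _ t] bdd_aboveI2[of _ _ 1]) auto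
qed

lemma outcome_uses_space:
  assumes "outcome (bounded_mem M) A r (init p b w)" "22 * real (floorlog 2 M) \<le> c"
  shows "uses_space p b w c"
proof -
  have "real (memory_bits s) \<le> c" if "(p', s, ws) \<in> set_pmf (steps t (init p b w))" for t p' s ws
  proof -
    have "memory_bits s \<le> 22 * floorlog 2 M"
      using outcome_invariant[OF assms(1) that] by (rule memory_bits_bounded_mem)
    then have "real (memory_bits s) \<le> 22 * real (floorlog 2 M)" by linarith
    then show ?thesis using assms(2) by linarith
  qed
  then show ?thesis unfolding uses_space_def by blast
qed

text \<open>Rounding to whole bits is paid once for the power and not once per factor, so only an
  additive 1 joins the term linear in i.\<close>

lemma floorlog_power_le:
  assumes "B > 0" "real B \<le> D * real n ^ 4" "n \<ge> 2" "D \<ge> 1"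
  shows "real (floorlog 2 (B ^ i)) \<le> real i * (log 2 D + 4) * log 2 (real n) + 1"
proof -
  have L: "1 \<le> log 2 (real n)" using assms(3) by simp
  have "real (floorlog 2 (B ^ i)) \<le> log 2 (real (B ^ i)) + 1"
  proof -
    have "B ^ i \<ge> 1" using assms(1) by simp
    then have "0 \<le> log 2 (real (B ^ i))" using assms(1) by (subst zero_le_log_cancel_iff) (auto simp del: of_nat_power)
    then show ?thesis using \<open>B ^ i \<ge> 1\<close> assms(1) by (simp add: floorlog_def del: of_nat_power)
  qed
  also have "log 2 (real (B ^ i)) = real i * log 2 (real B)" using assms(1) by (simp add: log_nat_power)
  also have "\<dots> \<le> real i * (log 2 (D * real n ^ 4))"
    using assms by (intro mult_left_mono) auto
  also have "log 2 (D * real n ^ 4) = log 2 D + 4 * log 2 (real n)"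
    using assms by (simp add: log_mult log_nat_power)
  also have "\<dots> \<le> (log 2 D + 4) * log 2 (real n)"
    using L assms(4) mult_left_mono[of 1 "log 2 (real n)" "log 2 D"] by (simp add: distrib_right)
  finally show ?thesis by (simp add: mult_left_mono mult.assoc)
qed

lemma sum_lessThan_add: "(\<Sum>z<a + c. f z) = (\<Sum>z<a. f z) + (\<Sum>z<c. f (a + z :: nat) :: real)"
  by (induction c) simp_all

text \<open>Mirrors one coin flip: the next bit of the point halves the dyadic range of the points
  that can still be reached.\<close>

lemma sum_dyadic_split:
  "(\<Sum>z<2 ^ Suc i. f (x * 2 ^ Suc i + z)) / 2 ^ Suc i =
    ((\<Sum>z<2 ^ i. f (2 * x * 2 ^ i + z)) / 2 ^ i + (\<Sum>z<2 ^ i. f ((2 * x + 1) * 2 ^ i + z)) / 2 ^ i) / (2 :: real)"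
  for x :: nat
proof -
  have "(\<Sum>z<2 ^ Suc i. f (x * 2 ^ Suc i + z)) =
      (\<Sum>z<2 ^ i. f (2 * x * 2 ^ i + z)) + (\<Sum>z<2 ^ i. f ((2 * x + 1) * 2 ^ i + z))"
    using sum_lessThan_add[of "\<lambda>z. f (x * 2 ^ Suc i + z)" "2 ^ i" "2 ^ i"]
    by (simp add: mult_2 algebra_simps)
  then show ?thesis by (simp add: field_simps)
qed

section \<open>Drawing the point and bounding the error\<close>

context ll_parser begin

text \<open>A terminal word is stuck and steps are deterministic. The word found for a fixed w is
  thus the only competitor of w, at every point.\<close>

lemma predict_final_unique:
  assumes "(predict G k b w)\<^sup>*\<^sup>* y (map Tm u)" "(predict G k b w)\<^sup>*\<^sup>* y (map Tm v)"
  shows "u = v"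
proof -
  have "(predict G k b w)\<^sup>*\<^sup>* (map Tm u) (map Tm v)"
    using deterministic_rtranclp_stuck[of "predict G k b w" "map Tm v" y "map Tm u"]
      predict_deterministic[OF LL] predict_map_Tm assms by blast
  then have "(map Tm u :: ('n, 't) symbol list) = map Tm v" using predict_map_Tm by (metis converse_rtranclpE)
  then show ?thesis by (simp add: inj_on_def inj_map_eq_map)
qed

lemma outcome_short:
  assumes "length w < 2"
  shows "outcome (\<lambda>_. True) True 0 (init recognizer b w)"
proof -
  have "wp (\<lambda>_. True) recognizer (\<lambda>s' ws'. s' 2 = 1) ((\<lambda>_. 0)(0 := length w, 1 := b)) w"
    unfolding recognizer_def using assms by (intro wp_Cond) (auto intro!: wp_Assign)
  then show ?thesis unfolding init_def by (rule outcome_wp) (auto intro!: outcome_halted)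
qed

text \<open>Variable \<open>3\<close> is left open, as it may still hold the last coin.\<close>

definition drawn :: "nat \<Rightarrow> 't list \<Rightarrow> nat \<Rightarrow> (nat \<Rightarrow> nat) \<Rightarrow> nat \<Rightarrow> nat \<Rightarrow> bool" where
  "drawn M w b s d x \<longleftrightarrow> bounded_mem M s \<and> s 0 = length w \<and> s 1 = b \<and> s 4 = d \<and> s 5 = x \<and>
    (\<forall>v. v \<notin> {0, 1, 3, 4, 5} \<longrightarrow> s v = 0)"

text \<open>After j flips with current value x, the i remaining flips lead to the points x 2^i + z
  with z < 2^i, all equally likely, and the rejection bound is the average over them. The induction
  runs backwards from the completed draw.\<close>

lemma outcome_draw_point:
  fixes Q :: nat and \<rho> :: "nat \<Rightarrow> real"
  assumes final: "\<And>s x. drawn M w b s Q x \<Longrightarrow> x < Q \<Longrightarrow> outcome (bounded_mem M) A (\<rho> x) (parse, s, w)"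
    and Q: "Q = 2 ^ J" "length w * length w \<le> Q" "\<And>j. j < J \<Longrightarrow> 2 ^ j < length w * length w" "Q \<le> M" "1 \<le> M"
  shows "j + i = J \<Longrightarrow> drawn M w b s (2 ^ j) x \<Longrightarrow> x < 2 ^ j \<Longrightarrow>
    outcome (bounded_mem M) A ((\<Sum>z<2 ^ i. \<rho> (x * 2 ^ i + z)) / 2 ^ i) (Seq draw_point parse, s, w)"
proof (induction i arbitrary: j s x)
  case 0
  then have s: "drawn M w b s Q x" "x < Q" using Q(1) by auto
  then have "bounded_mem M s" "s 0 = length w" "s 4 = Q" by (simp_all add: drawn_def)
  then have "wp (bounded_mem M) draw_point (\<lambda>s' ws'. s' = s \<and> ws' = w) s w"
    unfolding draw_point_def using Q(2)
    by (rule_tac wp_step[where c' = Skip and s' = s and ws' = w]) (simp_all add: wp_Skip)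
  then have "outcome (bounded_mem M) A (\<rho> x) (Seq draw_point parse, s, w)"
    by (rule outcome_wp_Seq) (use final[OF s] in auto)
  then show ?case by simp
next
  case (Suc i)
  define n where "n = length w"
  have s: "bounded_mem M s" "s 0 = n" "s 1 = b" "s 4 = 2 ^ j" "s 5 = x" "\<forall>v. v \<notin> {0, 1, 3, 4, 5} \<longrightarrow> s v = 0"
    using Suc.prems(2) unfolding n_def drawn_def by auto
  have lt: "2 ^ j < n * n" using Suc.prems by (auto simp: n_def intro!: Q(3))
  have "2 ^ Suc j \<le> Q" unfolding Q(1) using Suc.prems(1) by (intro power_increasing) auto
  then have qM: "2 * 2 ^ j \<le> M" using Q(4) by simp
  define D :: "'t prog" where "D = Seq (Assign 5 (Plus (Times (Const 2) point) tmp)) (Assign 4 (Times (Const 2) choices))"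
  have branch: "outcome (bounded_mem M) A ((\<Sum>z<2 ^ i. \<rho> ((2 * x + h) * 2 ^ i + z)) / 2 ^ i)
      (Seq (Seq (Seq Skip D) draw_point) parse, s(3 := h), w)" if h: "h \<le> 1" for h
  proof (rule outcome_wp_Seq_Seq)
    define s' where "s' = s(3 := h, 5 := 2 * x + h, 4 := 2 ^ Suc j)"
    have x2: "2 * x + h < 2 ^ Suc j" using Suc.prems(3) h by simp
    have bnd: "bounded_mem M (s(3 := h))" "bounded_mem M (s(3 := h, 5 := 2 * x + h))" "bounded_mem M s'"
      unfolding s'_def using s(1) h x2 qM Q(5) by simp_all
    then show "wp (bounded_mem M) (Seq Skip D) (\<lambda>s'' ws''. s'' = s' \<and> ws'' = w) (s(3 := h)) w"
      unfolding D_def s'_def using s by (intro wp_Seq wp_Skip wp_Assign) simp_all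
    have "drawn M w b s' (2 ^ Suc j) (2 * x + h)"
      unfolding drawn_def using s bnd(3) by (simp add: s'_def n_def)
    then have "outcome (bounded_mem M) A ((\<Sum>z<2 ^ i. \<rho> ((2 * x + h) * 2 ^ i + z)) / 2 ^ i)
        (Seq draw_point parse, s', w)"
      using Suc.prems(1) x2 by (intro Suc.IH[of "Suc j"]) simp_all
    then show "outcome (bounded_mem M) A ((\<Sum>z<2 ^ i. \<rho> ((2 * x + h) * 2 ^ i + z)) / 2 ^ i)
        (Seq draw_point parse, s'', ws'')" if "s'' = s' \<and> ws'' = w" for s'' ws''
      using that by simp
  qed
  define f where "f = (\<lambda>h. (Seq (Seq (Seq Skip D) draw_point) parse, s(3 := (if h then 1 else 0)), w))"
  have "outcome (bounded_mem M) A (((\<Sum>z<2 ^ i. \<rho> (2 * x * 2 ^ i + z)) / 2 ^ i +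
      (\<Sum>z<2 ^ i. \<rho> ((2 * x + 1) * 2 ^ i + z)) / 2 ^ i) / 2) (Seq (Seq (Seq (Flip 3) D) draw_point) parse, s, w)"
  proof (rule outcome_flip)
    show "small_step (Seq (Seq (Seq (Flip 3) D) draw_point) parse) s w = map_pmf f (bernoulli_pmf (1 / 2))"
      by (simp add: f_def map_pmf_comp)
  qed (use s(1) branch[of 0] branch[of 1] in \<open>simp_all add: f_def\<close>)
  then have "outcome (bounded_mem M) A ((\<Sum>z<2 ^ Suc i. \<rho> (x * 2 ^ Suc i + z)) / 2 ^ Suc i)
      (Seq (Seq (Seq (Flip 3) D) draw_point) parse, s, w)"
    by (subst sum_dyadic_split)
  then show ?case
    by (rule outcome_det[rotated 2]) (use s lt in \<open>simp_all add: draw_point_def D_def\<close>)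
qed

lemma exists_draw_length:
  fixes n :: nat
  assumes "2 \<le> n"
  obtains J where "n * n \<le> 2 ^ J" "\<And>j. j < J \<Longrightarrow> 2 ^ j < n * n" "2 ^ J \<le> 2 * (n * n)"
proof -
  define J where "J = (LEAST J. n * n \<le> 2 ^ J)"
  have ex: "n * n \<le> 2 ^ (n * n)" using less_exp[of "n * n"] by simp
  have J: "n * n \<le> 2 ^ J" unfolding J_def using ex by (rule LeastI)
  have less: "2 ^ j < n * n" if "j < J" for j
    using not_less_Least[OF that[unfolded J_def]] by simp
  have "2 ^ J \<le> 2 * (n * n)"
  proof (cases J)
    case 0
    then show ?thesis using assms by simp
  next
    case (Suc j)
    then show ?thesis using less[of j] by simp
  qed
  then show thesis using that J less by blast
qed

text \<open>Of the Q >= n^2 equally likely points at most n are collisions for a bad input, so the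
  error is at most n / Q <= 1 / n.\<close>

lemma recognizer_outcome:
  fixes w :: "'t list" and b :: nat
  defines "n \<equiv> length w" and "good \<equiv> w \<in> lang G \<and> grammar_rank G w \<le> b"
  assumes w: "w \<in> lists (alphabet G)" and b: "b > 0" and n: "n \<ge> 2"
  obtains B where "B > 0" "B \<le> (16 * (2 + W) ^ 2 + cst) * n ^ 4"
    "outcome (bounded_mem (B ^ (3 * (b + m) + 4))) good (if good then 0 else 1 - 1 / real n) (init recognizer b w)"
proof -
  obtain J where J: "n * n \<le> 2 ^ J" "\<And>j. j < J \<Longrightarrow> 2 ^ j < n * n" "2 ^ J \<le> 2 * (n * n)"
    using exists_draw_length[OF n] by blast
  define Q :: nat where "Q = 2 ^ J"
  define p where "p = (LEAST p. prime p \<and> Q + W \<le> p)"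
  obtain p' where p': "prime p'" "Q + W < p'" "p' \<le> 16 * (Q + W) ^ 2"
    using exists_prime_le_square[of "Q + W"] W_pos by auto
  have p: "prime p" "Q + W \<le> p"
    using LeastI[of "\<lambda>p. prime p \<and> Q + W \<le> p" p'] p' unfolding p_def by auto
  have p_least: "p \<le> r" if "prime r" "Q + W \<le> r" for r
    unfolding p_def using that by (intro Least_le) auto
  have "n \<le> n * n" using n by simp
  then have nQ: "n \<le> Q" using J(1) unfolding Q_def by (rule order_trans)
  have run: "ll_run G k e nc ents m w b x p" if "x < Q" for x
    using that w b p nQ prime_gt_1_nat[OF p(1)] unfolding n_def by unfold_locales auto
  have "0 < Q" by (simp add: Q_def)
  \<comment> \<open>Neither \<open>B\<close> nor \<open>M\<close> depends on the point, so the
    instance at point 0 supplies one memory bound for all outcomes of the draw.\<close>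
  interpret R: ll_run G k e nc ents m w b 0 p using run[OF \<open>0 < Q\<close>] .
  define good' where "good' \<longleftrightarrow> (predict G k b w)\<^sup>*\<^sup>* [Nt (start G)] (map Tm w)"
  define coll where "coll x = ll_run.collision G k e w b x p" for x
  have QM: "Q \<le> R.M" "1 \<le> R.M" using p(2) R.B_ge(1,5) R.B_le_M by simp_all
  have final: "outcome (bounded_mem R.M) good' (of_bool (\<not> coll x)) (parse, s, w)"
    if "drawn R.M w b s Q x" "x < Q" for s x
  proof -
    interpret Rx: ll_run G k e nc ents m w b x p using run[OF that(2)] .
    have "2 \<le> Q + W" using nQ n by simp
    then have "wp (bounded_mem R.M) parse
        (\<lambda>s' ws'. (good' \<longrightarrow> s' 2 \<noteq> 0) \<and> (s' 2 \<noteq> 0 \<longrightarrow> coll x)) s w"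
      unfolding good'_def coll_def
      using that(1) p p_least unfolding drawn_def by (intro Rx.wp_parse) auto
    then show ?thesis by (rule outcome_wp) (auto intro!: outcome_halted)
  qed
  have draw: "outcome (bounded_mem R.M) good' ((\<Sum>z<2 ^ J. of_bool (\<not> coll (0 * 2 ^ J + z))) / 2 ^ J)
      (Seq draw_point parse, s, w)" if "drawn R.M w b s (2 ^ 0) 0" for s
    using outcome_draw_point[of R.M w b Q good' "\<lambda>x. of_bool (\<not> coll x)" J 0 J s 0,
        OF final Q_def _ _ QM] J that by (simp add: Q_def n_def)
  define s0 :: "nat \<Rightarrow> nat" where "s0 = (\<lambda>_. 0)(0 := length w, 1 := b)"
  have nM: "n \<le> R.M" using nQ QM(1) by linarith
  have bM: "b \<le> R.M" using R.bm_le_M by simp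
  have s0: "bounded_mem R.M s0"
    using nM bM by (simp add: s0_def bounded_mem_def n_def)
  have "drawn R.M w b (s0(4 := 1)) (2 ^ 0) 0"
    using s0 QM(2) unfolding drawn_def by (simp add: s0_def)
  note at_start = draw[OF this]
  define r where "r = (\<Sum>z<2 ^ J. of_bool (\<not> coll z)) / (2 ^ J :: real)"
  have "outcome (bounded_mem R.M) good' r (Seq (Assign 4 (Const 1)) (Seq draw_point parse), s0, w)"
  proof (rule outcome_wp_Seq)
    show "wp (bounded_mem R.M) (Assign 4 (Const 1)) (\<lambda>s' ws'. s' = s0(4 := 1) \<and> ws' = w) s0 w"
      using s0 QM(2) by (intro wp_Assign) simp_all
  qed (use at_start in \<open>auto simp: r_def\<close>)
  then have out: "outcome (bounded_mem R.M) good' r (init recognizer b w)"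
    unfolding init_def s0_def[symmetric]
    by (rule outcome_det[rotated 2]) (use s0 n in \<open>simp_all add: recognizer_def s0_def n_def\<close>)
  have good: "good' \<longleftrightarrow> good"
    unfolding good'_def good_def using predict_iff_lang_rank[OF LL w b] .
  have r: "(if good then 0 else 1 - 1 / real n) \<le> r"
  proof (cases good)
    case True
    then show ?thesis by (simp add: r_def sum_nonneg)
  next
    case False
    \<comment> \<open>If no word of length n is predicted, there are no collisions; otherwise the
      predicted word is unique and, the input being bad, differs from w.\<close>
    have "card {x. x < Q \<and> coll x} \<le> n"
    proof (cases "\<exists>v. (predict G k b w)\<^sup>*\<^sup>* [Nt (start G)] (map Tm v) \<and> length v = n")
      case True
      then obtain v where v: "(predict G k b w)\<^sup>*\<^sup>* [Nt (start G)] (map Tm v)" "length v = n" by blast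
      have "v \<noteq> w" using v(1) False good unfolding good'_def by auto
      obtain i where "(predict G k b w ^^ i) [Nt (start G)] (map Tm v)"
        using v(1) by (auto dest: rtranclp_imp_relpowp)
      then have "set (map Tm v) \<subseteq> Nt ` nonterminals G \<union> Tm ` alphabet G"
        using R.predicts_invariant by blast
      then have "set v \<subseteq> alphabet G" by auto
      then have "card {x. x < p \<and> horner_sum e x v mod p = horner_sum e x w mod p} < length v"
        using v(2) w \<open>v \<noteq> w\<close> e_less_W p(2) e_inj
        by (intro card_hash_collisions[OF p(1), where S = "alphabet G"]) (fastforce simp: n_def)+
      moreover have "{x. x < Q \<and> coll x} \<subseteq> {x. x < p \<and> horner_sum e x v mod p = horner_sum e x w mod p}"
      proof clarify
        fix x assume x: "x < Q" "coll x"
        obtain u where u: "(predict G k b w)\<^sup>*\<^sup>* [Nt (start G)] (map Tm u)"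
          "horner_sum e x u mod p = horner_sum e x w mod p"
          using x(2) unfolding coll_def ll_run.collision_def[OF run[OF x(1)]] by blast
        have "u = v" using predict_final_unique[OF u(1) v(1)] .
        then show "x < p \<and> horner_sum e x v mod p = horner_sum e x w mod p"
          using u(2) x(1) p(2) by simp
      qed
      then have "card {x. x < Q \<and> coll x} \<le> card {x. x < p \<and> horner_sum e x v mod p = horner_sum e x w mod p}"
        by (rule card_mono[rotated]) simp
      ultimately show ?thesis using v(2) by simp
    next
      case False
      have "\<not> coll x" if "x < Q" for x
        using False unfolding coll_def ll_run.collision_def[OF run[OF that]] n_def by blast
      then have "{x. x < Q \<and> coll x} = {}" by blast
      then show ?thesis by (simp only: card.empty)
    qed
    moreover have "(\<Sum>z<Q. of_bool (\<not> coll z) :: real) = real Q - real (card {x. x < Q \<and> coll x})"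
    proof -
      have "(\<Sum>z<Q. of_bool (\<not> coll z) :: real) = (\<Sum>z<Q. 1 - of_bool (coll z))"
        by (intro sum.cong) auto
      also have "\<dots> = real Q - (\<Sum>z<Q. of_bool (coll z))" by (simp add: sum_subtractf)
      also have "(\<Sum>z<Q. of_bool (coll z) :: real) = real (card ({..<Q} \<inter> {x. coll x}))"
        by (simp add: sum_of_bool_eq)
      also have "{..<Q} \<inter> {x. coll x} = {x. x < Q \<and> coll x}" by auto
      finally show ?thesis .
    qed
    ultimately have "real Q - real n \<le> (\<Sum>z<Q. of_bool (\<not> coll z) :: real)" by simp
    then have "(real Q - real n) / real Q \<le> r"
      unfolding r_def Q_def by (simp add: divide_right_mono)
    moreover have "1 - 1 / real n \<le> (real Q - real n) / real Q"
    proof -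
      have "real (n * n) \<le> real Q" using J(1) unfolding Q_def by (rule of_nat_mono)
      then have "real n * real n \<le> real Q" by simp
      then have "real n / real Q \<le> 1 / real n" using n \<open>0 < Q\<close> by (simp add: field_simps)
      then show ?thesis using \<open>0 < Q\<close> by (simp add: diff_divide_distrib)
    qed
    ultimately show ?thesis using False by simp
  qed
  show thesis
  proof (rule that)
    show "0 < R.B" using R.B_ge(5) by simp
    show "R.B \<le> (16 * (2 + W) ^ 2 + cst) * n ^ 4"
    proof -
      \<comment> \<open>From Q <= 2 n^2 follows Q + \<open>W\<close> <= (2 + \<open>W\<close>) n^2,
        and the prime bound squares this to the fourth power of n.\<close>
      have "1 \<le> n * n" using n by simp
      then have "W * 1 \<le> W * (n * n)" by (intro mult_left_mono) auto
      then have "Q + W \<le> (2 + W) * (n * n)" using J(3) unfolding Q_def distrib_right by linarith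
      then have "(Q + W) ^ 2 \<le> ((2 + W) * (n * n)) ^ 2" by (intro power_mono) auto
      also have "\<dots> = (2 + W) ^ 2 * (n ^ 2 * n ^ 2)" by (simp only: power_mult_distrib)
      also have "n ^ 2 * n ^ 2 = n ^ 4" by (simp flip: power_add)
      finally have "p \<le> 16 * ((2 + W) ^ 2 * n ^ 4)" using p_least[OF p'(1)] p'(2,3) by linarith
      moreover have "cst \<le> cst * n ^ 4" using n by simp
      ultimately show ?thesis unfolding R.B_def distrib_right mult.assoc by (rule add_mono)
    qed
    show "outcome (bounded_mem (R.B ^ (3 * (b + m) + 4))) good (if good then 0 else 1 - 1 / real n) (init recognizer b w)"
      using outcome_mono[OF out r] unfolding good R.M_def .
  qed
qed

end

theorem theorem3:
  fixes G :: "('n, 't) cfg" and k :: nat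
  assumes "wf_cfg G" and "LL k G"
  shows "\<exists>(p :: 't prog) (C :: real).
    \<forall>(n :: nat) (b :: nat) (w :: 't list).
      b > 0 \<and> w \<in> lists (alphabet G) \<and> length w = n \<longrightarrow>
        (n \<ge> 2 \<longrightarrow> uses_space p b w (C * real b * log 2 (real n))) \<and>
        (w \<in> lang G \<and> grammar_rank G w \<le> b \<longrightarrow> accept_prob p b w = 1) \<and>
        (n > 0 \<and> (w \<notin> lang G \<or> grammar_rank G w > b) \<longrightarrow> reject_prob p b w \<ge> 1 - 1 / real n)"
proof -
  have fin: "finite (nonterminals G)" "finite (alphabet G)" "finite (productions G)"
    using assms(1) by (auto simp: wf_cfg_def)
  obtain e where e: "bij_betw e (alphabet G) {0..<card (alphabet G)}"
    using ex_bij_betw_finite_nat[OF fin(2)] by blast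
  obtain nc where nc: "bij_betw nc (nonterminals G) {0..<card (nonterminals G)}"
    using ex_bij_betw_finite_nat[OF fin(1)] by blast
  \<comment> \<open>Lookahead k + 1 instead of k guarantees a nonempty window. The table is finite,
    as lookaheads are words of at most k + 1 letters over a finite alphabet.\<close>
  define E where "E = {(A, u, \<alpha>). (A, \<alpha>) \<in> productions G \<and> u \<in> select G (Suc k) (A, \<alpha>)}"
  have "E \<subseteq> (\<lambda>((A, \<alpha>), u). (A, u, \<alpha>)) ` (productions G \<times> {u. set u \<subseteq> alphabet G \<and> length u \<le> Suc k})"
  proof
    fix t assume "t \<in> E"
    then obtain A u \<alpha> where t: "t = (A, u, \<alpha>)" "(A, \<alpha>) \<in> productions G" "u \<in> select G (Suc k) (A, \<alpha>)"
      unfolding E_def by auto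
    from t(3) obtain v where "v \<in> lists (alphabet G)" "u = take (Suc k) v"
      unfolding select_def by blast
    then have "set u \<subseteq> alphabet G \<and> length u \<le> Suc k" by (auto dest: in_set_takeD)
    then show "t \<in> (\<lambda>((A, \<alpha>), u). (A, u, \<alpha>)) ` (productions G \<times> {u. set u \<subseteq> alphabet G \<and> length u \<le> Suc k})"
      using t by (intro image_eqI[of _ _ "((A, \<alpha>), u)"]) auto
  qed
  moreover have "finite (productions G \<times> {u. set u \<subseteq> alphabet G \<and> length u \<le> Suc k})"
    using fin finite_lists_length_le[OF fin(2)] by blast
  ultimately have "finite E" by (meson finite_imageI finite_subset)
  then obtain ents where ents: "set ents = E" using finite_list by blast
  obtain m where m: "\<And>A \<alpha>. (A, \<alpha>) \<in> productions G \<Longrightarrow> length \<alpha> \<le> m"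
  proof -
    have "finite ((\<lambda>p. length (snd p)) ` productions G)" using fin(3) by simp
    then obtain m where "\<forall>l \<in> (\<lambda>p. length (snd p)) ` productions G. l \<le> m"
      using finite_nat_set_iff_bounded_le by blast
    then show thesis using that[of m] by force
  qed
  \<comment> \<open>The bijections count from 0; \<open>Suc\<close> makes the codes start at
    1.\<close>
  interpret ll_parser G "Suc k" "\<lambda>a. Suc (e a)" "\<lambda>A. Suc (nc A)" ents m
  proof
    show "inj_on (\<lambda>a. Suc (e a)) (alphabet G)" using e by (auto simp: bij_betw_def inj_on_def)
    show "inj_on (\<lambda>A. Suc (nc A)) (nonterminals G)" using nc by (auto simp: bij_betw_def inj_on_def)
    show "0 < Suc (e a) \<and> Suc (e a) \<le> card (alphabet G)" if "a \<in> alphabet G" for a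
      using bij_betwE[OF e] that by (auto simp: Suc_le_eq)
    show "0 < Suc (nc A) \<and> Suc (nc A) \<le> card (nonterminals G)" if "A \<in> nonterminals G" for A
      using bij_betwE[OF nc] that by (auto simp: Suc_le_eq)
    show "wf_cfg G" "LL (Suc k) G" using assms(1) LL_Suc[OF assms(2)] .
    show "set ents = {(A, u, \<alpha>). (A, \<alpha>) \<in> productions G \<and> u \<in> select G (Suc k) (A, \<alpha>)}"
      using ents unfolding E_def .
  qed (simp_all add: m)
  define D where "D = 16 * (2 + W) ^ 2 + cst"
  \<comment> \<open>22 variables; \<open>3 * real m + 7\<close> comes from 3 (b + m) + 4 <= (3 m +
    7) b, \<open>log 2 (real D) + 4\<close> from the base being at most D n^4, and the last 1 from
    rounding to whole bits. Additive terms are absorbed by b >= 1 and log n >= 1.\<close>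
  define C where "C = 22 * ((3 * real m + 7) * (log 2 (real D) + 4) + 1)"
  show ?thesis
  proof (intro exI[of _ recognizer] exI[of _ C] allI impI conjI; elim conjE)
    fix n b :: nat and w :: "'t list"
    assume b: "b > 0" and w: "w \<in> lists (alphabet G)" and n: "length w = n"
    define good where "good \<longleftrightarrow> w \<in> lang G \<and> grammar_rank G w \<le> b"
    have long: "\<exists>M. 22 * real (floorlog 2 M) \<le> C * real b * log 2 (real n) \<and>
        outcome (bounded_mem M) good (if good then 0 else 1 - 1 / real n) (init recognizer b w)" if n2: "n \<ge> 2"
    proof -
      obtain B where B: "B > 0" "B \<le> D * n ^ 4"
        "outcome (bounded_mem (B ^ (3 * (b + m) + 4))) good (if good then 0 else 1 - 1 / real n) (init recognizer b w)"
        using recognizer_outcome[OF w b] n2 unfolding n D_def good_def by metis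
      have D1: "D \<ge> 1" by (simp add: D_def cst_def)
      define i where "i = 3 * (b + m) + 4"
      define L where "L = log 2 (real n)"
      have L: "1 \<le> L" using n2 by (simp add: L_def)
      have "real B \<le> real D * real n ^ 4" using of_nat_mono[OF B(2), where 'a = real] by simp
      then have "real (floorlog 2 (B ^ i)) \<le> real i * (log 2 (real D) + 4) * L + 1"
        unfolding L_def using B(1) n2 D1 by (intro floorlog_power_le) auto
      also have "\<dots> \<le> ((3 * real m + 7) * real b) * (log 2 (real D) + 4) * L + real b * L"
      proof (intro add_mono mult_right_mono)
        have "m * 1 \<le> m * b" using b by (intro mult_left_mono) auto
        then have "i \<le> (3 * m + 7) * b"
          using b unfolding i_def by (simp only: distrib_left distrib_right mult.assoc)
        then have "real i \<le> real ((3 * m + 7) * b)" by (simp only: of_nat_le_iff)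
        then show "real i \<le> (3 * real m + 7) * real b" by simp
        show "1 \<le> real b * L" using b L mult_mono[of 1 "real b" 1 L] by simp
      qed (use D1 L in auto)
      finally have "22 * real (floorlog 2 (B ^ i)) \<le> C * real b * log 2 (real n)"
        by (simp add: C_def L_def algebra_simps)
      then show ?thesis using B(3) unfolding i_def by blast
    qed
    show "uses_space recognizer b w (C * real b * log 2 (real n))" if "n \<ge> 2"
      using outcome_uses_space long[OF that] by blast
    show "accept_prob recognizer b w = 1" if "w \<in> lang G" "grammar_rank G w \<le> b"
    proof (cases "n \<ge> 2")
      case True
      have good using that by (simp add: good_def)
      then show ?thesis using long[OF True] by (auto intro: outcome_accept_prob)
    next
      case False
      then have "length w < 2" using n by simp
      then show ?thesis by (rule outcome_accept_prob[OF outcome_short])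
    qed
    show "1 - 1 / real n \<le> reject_prob recognizer b w" if "n > 0" "w \<notin> lang G \<or> grammar_rank G w > b"
    proof (cases "n \<ge> 2")
      case True
      have "\<not> good" using that by (auto simp: good_def)
      then show ?thesis using long[OF True] by (auto intro: outcome_reject_prob)
    next
      case False
      then have "n = 1" "length w < 2" using that n by simp_all
      then show ?thesis using outcome_reject_prob[OF outcome_short, of w b] by simp
    qed
  qed
qed

end
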